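(* The construction sending a partitioned set $(X,\sim)$ to $X/{\sim}$ and a partitioned subdistribution matrix $M$ of shape $(X,Y)$ to its aggregated matrix $\mathsf{Q}M$ of shape $(X/{\sim},Y/{\sim})$, $$(\mathsf{Q}M)_{[x],[y]}=\sum_{y'\in[y]}M_{x,y'},$$ defines a strong monoidal functor $$\mathsf{Q}\colon(\mathbf{psubMat},\otimes,\mathbf 1)\to(\mathbf{subMat},\otimes,\mathbf 1).$$
   Context: A matrix of shape $(X,Y)$, for sets $X,Y$, is a function $M\colon X\times Y\to\mathbb R$. A subdistribution on $X$ is a finitely supported function $p\colon X\to[0,1]$ with $\sum_xp_x\le1$. A subdistribution matrix of shape $(X,Y)$ is a matrix all of whose rows $M_{x,-}\colon Y\to[0,1]$ are subdistributions. Products: $(MN)_{x,z}=\sum_yM_{x,y}N_{y,z}$ (composition in diagrammatic order) and $(pM)_y=\sum_xp_xM_{x,y}$. $\mathbf{subMat}$ is the category whose objects are sets and whose morphisms $X\to Y$ are subdistribution matrices of shape $(X,Y)$, composed by matrix multiplication. It is symmetric monoidal with the cartesian product of sets on objects, the Kronecker product $(M\otimes N)_{(x,u),(y,v)}=M_{x,y}N_{u,v}$ on morphisms, and unit the one-point set $\mathbf 1$. A partitioned set $(X,\sim)$ is a set with an equivalence relation; the product of partitioned sets has $(x,y)\sim(x',y')$ iff $x\sim x'$ and $y\sim y'$. Subdistributions $p,q$ on $X$ are equivalent, $p\sim q$, if $\sum_{x'\in[x]}p_{x'}=\sum_{x'\in[x]}q_{x'}$ for all $x\in X$. A subdistribution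 matrix $M$ of shape $(X,Y)$ between partitioned sets is partitioned if $p\sim q$ implies $pM\sim qM$ for all subdistributions $p,q$ on $X$. $\mathbf{psubMat}$ is the category of partitioned sets and partitioned subdistribution matrices, composed by matrix multiplication; it is symmetric monoidal with the product of partitioned sets on objects, the Kronecker product on morphisms, and unit $\mathbf 1$ (with its unique equivalence relation). *)

theory Defs
  imports "HOL-Analysis.Analysis" "HOL-Library.Equipollence"
begin

section \<open>Monoidal categories and strong monoidal functors\<close>

text \<open>Composition is written in diagrammatic order: \<open>Comp C f g\<close> is first \<open>f\<close>, then \<open>g\<close>.\<close>

record ('o, 'a) cat =
  Obj :: "'o set"
  Arr :: "'a set"
  Dom :: "'a \<Rightarrow> 'o"
  Cod :: "'a \<Rightarrow> 'o"
  Ident :: "'o \<Rightarrow> 'a"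
  Comp :: "'a \<Rightarrow> 'a \<Rightarrow> 'a"

definition hom :: "('o, 'a, 'x) cat_scheme \<Rightarrow> 'o \<Rightarrow> 'o \<Rightarrow> 'a set" where
  "hom C A B = {f \<in> Arr C. Dom C f = A \<and> Cod C f = B}"

locale category =
  fixes C :: "('o, 'a, 'x) cat_scheme"
  assumes Dom_Obj: "f \<in> Arr C \<Longrightarrow> Dom C f \<in> Obj C"
    and Cod_Obj: "f \<in> Arr C \<Longrightarrow> Cod C f \<in> Obj C"
    and Ident_hom: "A \<in> Obj C \<Longrightarrow> Ident C A \<in> hom C A A"
    and Comp_hom: "f \<in> hom C A B \<Longrightarrow> g \<in> hom C B D \<Longrightarrow> Comp C f g \<in> hom C A D"
    and Ident_Comp: "f \<in> hom C A B \<Longrightarrow> Comp C (Ident C A) f = f"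
    and Comp_Ident: "f \<in> hom C A B \<Longrightarrow> Comp C f (Ident C B) = f"
    and Comp_assoc: "f \<in> hom C A B \<Longrightarrow> g \<in> hom C B D \<Longrightarrow> h \<in> hom C D E \<Longrightarrow>
      Comp C (Comp C f g) h = Comp C f (Comp C g h)"

definition is_iso :: "('o, 'a, 'x) cat_scheme \<Rightarrow> 'o \<Rightarrow> 'o \<Rightarrow> 'a \<Rightarrow> bool" where
  "is_iso C A B f \<longleftrightarrow> f \<in> hom C A B \<and>
    (\<exists>g \<in> hom C B A. Comp C f g = Ident C A \<and> Comp C g f = Ident C B)"

record ('o, 'a) moncat = "('o, 'a) cat" +
  TensorO :: "'o \<Rightarrow> 'o \<Rightarrow> 'o"
  TensorA :: "'a \<Rightarrow> 'a \<Rightarrow> 'a"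
  UnitO :: "'o"
  Assoc :: "'o \<Rightarrow> 'o \<Rightarrow> 'o \<Rightarrow> 'a"
  LUnit :: "'o \<Rightarrow> 'a"
  RUnit :: "'o \<Rightarrow> 'a"

locale monoidal_category = category C
  for C :: "('o, 'a, 'x) moncat_scheme" +
  assumes TensorO_Obj: "A \<in> Obj C \<Longrightarrow> B \<in> Obj C \<Longrightarrow> TensorO C A B \<in> Obj C"
    and UnitO_Obj: "UnitO C \<in> Obj C"
    and TensorA_hom: "f \<in> hom C A A' \<Longrightarrow> g \<in> hom C B B' \<Longrightarrow>
      TensorA C f g \<in> hom C (TensorO C A B) (TensorO C A' B')"
    and TensorA_Ident: "A \<in> Obj C \<Longrightarrow> B \<in> Obj C \<Longrightarrow>
      TensorA C (Ident C A) (Ident C B) = Ident C (TensorO C A B)"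
    and TensorA_Comp: "f \<in> hom C A A' \<Longrightarrow> f' \<in> hom C A' A'' \<Longrightarrow>
      g \<in> hom C B B' \<Longrightarrow> g' \<in> hom C B' B'' \<Longrightarrow>
      TensorA C (Comp C f f') (Comp C g g') = Comp C (TensorA C f g) (TensorA C f' g')"
    and Assoc_iso: "A \<in> Obj C \<Longrightarrow> B \<in> Obj C \<Longrightarrow> D \<in> Obj C \<Longrightarrow>
      is_iso C (TensorO C (TensorO C A B) D) (TensorO C A (TensorO C B D)) (Assoc C A B D)"
    and LUnit_iso: "A \<in> Obj C \<Longrightarrow> is_iso C (TensorO C (UnitO C) A) A (LUnit C A)"
    and RUnit_iso: "A \<in> Obj C \<Longrightarrow> is_iso C (TensorO C A (UnitO C)) A (RUnit C A)"
    and Assoc_natural: "f \<in> hom C A A' \<Longrightarrow> g \<in> hom C B B' \<Longrightarrow> h \<in> hom C D D' \<Longrightarrow>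
      Comp C (TensorA C (TensorA C f g) h) (Assoc C A' B' D')
        = Comp C (Assoc C A B D) (TensorA C f (TensorA C g h))"
    and LUnit_natural: "f \<in> hom C A A' \<Longrightarrow>
      Comp C (TensorA C (Ident C (UnitO C)) f) (LUnit C A') = Comp C (LUnit C A) f"
    and RUnit_natural: "f \<in> hom C A A' \<Longrightarrow>
      Comp C (TensorA C f (Ident C (UnitO C))) (RUnit C A') = Comp C (RUnit C A) f"
    and pentagon: "A \<in> Obj C \<Longrightarrow> B \<in> Obj C \<Longrightarrow> D \<in> Obj C \<Longrightarrow> E \<in> Obj C \<Longrightarrow>
      Comp C (Assoc C (TensorO C A B) D E) (Assoc C A B (TensorO C D E))
        = Comp C (Comp C (TensorA C (Assoc C A B D) (Ident C E)) (Assoc C A (TensorO C B D) E))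
                 (TensorA C (Ident C A) (Assoc C B D E))"
    and triangle: "A \<in> Obj C \<Longrightarrow> B \<in> Obj C \<Longrightarrow>
      Comp C (Assoc C A (UnitO C) B) (TensorA C (Ident C A) (LUnit C B))
        = TensorA C (RUnit C A) (Ident C B)"

locale cat_functor = C: category C + D: category D
  for C :: "('o, 'a, 'x) cat_scheme" and D :: "('p, 'b, 'y) cat_scheme" +
  fixes Fo :: "'o \<Rightarrow> 'p" and Fa :: "'a \<Rightarrow> 'b"
  assumes Fo_Obj: "A \<in> Obj C \<Longrightarrow> Fo A \<in> Obj D"
    and Fa_hom: "f \<in> hom C A B \<Longrightarrow> Fa f \<in> hom D (Fo A) (Fo B)"
    and Fa_Ident: "A \<in> Obj C \<Longrightarrow> Fa (Ident C A) = Ident D (Fo A)"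
    and Fa_Comp: "f \<in> hom C A B \<Longrightarrow> g \<in> hom C B E \<Longrightarrow>
      Fa (Comp C f g) = Comp D (Fa f) (Fa g)"

locale strong_monoidal_functor =
  C: monoidal_category C + D: monoidal_category D + cat_functor C D Fo Fa
  for C :: "('o, 'a, 'x) moncat_scheme" and D :: "('p, 'b, 'y) moncat_scheme"
    and Fo :: "'o \<Rightarrow> 'p" and Fa :: "'a \<Rightarrow> 'b" +
  fixes mult :: "'o \<Rightarrow> 'o \<Rightarrow> 'b" and unit :: "'b"
  assumes mult_iso: "A \<in> Obj C \<Longrightarrow> B \<in> Obj C \<Longrightarrow>
      is_iso D (TensorO D (Fo A) (Fo B)) (Fo (TensorO C A B)) (mult A B)"
    and unit_iso: "is_iso D (UnitO D) (Fo (UnitO C)) unit"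
    and mult_natural: "f \<in> hom C A A' \<Longrightarrow> g \<in> hom C B B' \<Longrightarrow>
      Comp D (TensorA D (Fa f) (Fa g)) (mult A' B') = Comp D (mult A B) (Fa (TensorA C f g))"
    and mult_assoc: "A \<in> Obj C \<Longrightarrow> B \<in> Obj C \<Longrightarrow> E \<in> Obj C \<Longrightarrow>
      Comp D (Comp D (TensorA D (mult A B) (Ident D (Fo E))) (mult (TensorO C A B) E))
             (Fa (Assoc C A B E))
        = Comp D (Comp D (Assoc D (Fo A) (Fo B) (Fo E)) (TensorA D (Ident D (Fo A)) (mult B E)))
                 (mult A (TensorO C B E))"
    and mult_LUnit: "A \<in> Obj C \<Longrightarrow>
      Comp D (Comp D (TensorA D unit (Ident D (Fo A))) (mult (UnitO C) A)) (Fa (LUnit C A))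
        = LUnit D (Fo A)"
    and mult_RUnit: "A \<in> Obj C \<Longrightarrow>
      Comp D (Comp D (TensorA D (Ident D (Fo A)) unit) (mult A (UnitO C))) (Fa (RUnit C A))
        = RUnit D (Fo A)"


section \<open>Universes of sets\<close>

text \<open>
  Cartesian products and quotients change the HOL type of a set, whereas the objects of a category
  have to share one type. The sets under consideration are therefore the small subsets of a
  universe \<open>'u\<close>. Smallness obeys separation and replacement, and small sets are closed under
  cartesian products; ordered pairs of elements and small sets of elements are again (coded by)
  elements of the universe. In particular, the classes of an equivalence relation on a small set
  are elements.
\<close>

record 'u universe =
  small :: "'u set \<Rightarrow> bool"
  pair :: "'u \<times> 'u \<Rightarrow> 'u"
  pt :: "'u"
  enc :: "'u set \<Rightarrow> 'u"

definition uprod :: "'u universe \<Rightarrow> 'u set \<Rightarrow> 'u set \<Rightarrow> 'u set" where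
  "uprod U X Y = pair U ` (X \<times> Y)"

locale universe =
  fixes U :: "'u universe"
  assumes small_one: "small U {pt U}"
    and small_subset: "small U X \<Longrightarrow> Y \<subseteq> X \<Longrightarrow> small U Y"
    and small_image: "small U X \<Longrightarrow> small U (f ` X)"
    and small_prod: "small U X \<Longrightarrow> small U Y \<Longrightarrow> small U (uprod U X Y)"
    and inj_pair: "inj (pair U)"
    and inj_enc: "inj_on (enc U) {X. small U X}"

text \<open>
  Universes exist in every size: over any infinite type \<open>'k\<close> there is one in which all sets of
  cardinality at most that of \<open>'k\<close> are small. So the notion is not vacuous, and every set of every
  HOL type is equinumerous with a small set of some universe.
\<close>

lemma universe_exists:
  assumes "infinite (UNIV :: 'k set)"
  shows "\<exists>U :: 'k set universe. universe U \<and>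
    (\<forall>Z :: 'k set set. Z \<lesssim> (UNIV :: 'k set) \<longrightarrow> small U Z)"
proof -
  obtain b :: "'k \<times> 'k \<Rightarrow> 'k" where b: "bij b"
    using card_of_ordIso[THEN iffD2, OF card_of_Times_same_infinite[OF assms]] by auto
  then have ib: "inj b" by (rule bij_is_inj)
  obtain k0 k1 :: 'k where k01: "k0 \<noteq> k1"
  proof -
    have "UNIV \<noteq> {undefined :: 'k}" using assms by (metis finite.emptyI finite.insertI)
    then show ?thesis using that by auto
  qed
  define sm :: "'k set set \<Rightarrow> bool" where "sm = (\<lambda>X. \<exists>f :: 'k \<Rightarrow> 'k set. X \<subseteq> range f)"
  have smI: "sm X" if "X \<subseteq> range f" for X and f :: "'k \<Rightarrow> 'k set"
    using that unfolding sm_def by (rule exI[of _ f])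
  define pr :: "'k set \<times> 'k set \<Rightarrow> 'k set" where
    "pr = (\<lambda>(x, y). b ` ({k0} \<times> x \<union> {k1} \<times> y))"
  have rng: "\<exists>f :: 'k \<Rightarrow> 'k set. range f = X" if "sm X" "X \<noteq> {}" for X
  proof -
    obtain f :: "'k \<Rightarrow> 'k set" where f: "X \<subseteq> range f" using \<open>sm X\<close> by (auto simp: sm_def)
    obtain a where a: "a \<in> X" using \<open>X \<noteq> {}\<close> by auto
    have "range (\<lambda>k. if f k \<in> X then f k else a) = X" using f a by force
    then show ?thesis by (intro exI[of _ "\<lambda>k. if f k \<in> X then f k else a"])
  qed
  define gr :: "('k \<Rightarrow> 'k set) \<Rightarrow> ('k \<times> 'k) set" where "gr = (\<lambda>f. {(k, j). j \<in> f k})"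
  define en :: "'k set set \<Rightarrow> 'k set" where
    "en = (\<lambda>X. if X = {} then {} else
       b ` (insert (k0, k0) ({k1} \<times> b ` gr (SOME f. range f = X))))"
  have inj_gr: "f = g" if "gr f = gr g" for f g
  proof
    fix k
    have "j \<in> f k \<longleftrightarrow> j \<in> g k" for j
      using arg_cong[OF that, of "\<lambda>G. (k, j) \<in> G"] by (simp add: gr_def)
    then show "f k = g k" by blast
  qed
  have inj_en: "inj_on en {X. sm X}"
  proof (rule inj_onI, unfold mem_Collect_eq)
    fix X Y assume XY: "sm X" "sm Y" and eq: "en X = en Y"
    have en_empty: "en Z = {} \<longleftrightarrow> Z = {}" for Z
      by (simp add: en_def)
    show "X = Y"
    proof (cases "X = {} \<or> Y = {}")
      case True
      then have "X = {} \<and> Y = {}" unfolding en_empty[symmetric] eq by simp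
      then show ?thesis by simp
    next
      case False
      define f :: "'k \<Rightarrow> 'k set" where "f = (SOME f. range f = X)"
      define g :: "'k \<Rightarrow> 'k set" where "g = (SOME f. range f = Y)"
      have r: "range f = X" "range g = Y"
        using False someI_ex[OF rng[OF XY(1)]] someI_ex[OF rng[OF XY(2)]]
        unfolding f_def g_def by simp_all
      have "b ` (insert (k0, k0) ({k1} \<times> b ` gr f)) = b ` (insert (k0, k0) ({k1} \<times> b ` gr g))"
        using eq False unfolding en_def f_def g_def by presburger
      then have "insert (k0, k0) ({k1} \<times> b ` gr f) = insert (k0, k0) ({k1} \<times> b ` gr g)"
        unfolding inj_image_eq_iff[OF ib] .
      then have "insert (k0, k0) ({k1} \<times> b ` gr f) `` {k1} = insert (k0, k0) ({k1} \<times> b ` gr g) `` {k1}"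
        by (rule arg_cong)
      then have "b ` gr f = b ` gr g"
        using k01 unfolding Image_def by simp
      then have "f = g"
        unfolding inj_image_eq_iff[OF ib] by (rule inj_gr)
      with r show ?thesis by blast
    qed
  qed
  have inj_pr: "inj pr"
  proof (rule injI, clarify)
    fix x y x' y' assume "pr (x, y) = pr (x', y')"
    then have "{k0} \<times> x \<union> {k1} \<times> y = {k0} \<times> x' \<union> {k1} \<times> y'"
      by (simp add: pr_def inj_image_eq_iff[OF ib])
    from arg_cong[OF this, of "\<lambda>G. G `` {k0}"] arg_cong[OF this, of "\<lambda>G. G `` {k1}"]
    show "x = x' \<and> y = y'" using k01 unfolding Image_def by simp
  qed
  have sm_pr: "sm (pr ` (X \<times> Y))" if X: "sm X" and Y: "sm Y" for X Y
  proof -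
    obtain f g :: "'k \<Rightarrow> 'k set" where fg: "X \<subseteq> range f" "Y \<subseteq> range g"
      using X Y by (auto simp: sm_def)
    have "pr ` (X \<times> Y) \<subseteq> range (\<lambda>k. pr (f (fst (inv b k)), g (snd (inv b k))))"
    proof clarify
      fix x y assume "x \<in> X" "y \<in> Y"
      then obtain i j where "x = f i" "y = g j" using fg by blast
      then have "pr (x, y) = pr (f (fst (inv b (b (i, j)))), g (snd (inv b (b (i, j)))))"
        using ib by simp
      then show "pr (x, y) \<in> range (\<lambda>k. pr (f (fst (inv b k)), g (snd (inv b k))))" by blast
    qed
    then show ?thesis by (rule smI)
  qed
  let ?U = "\<lparr>small = sm, pair = pr, pt = {}, enc = en\<rparr>"
  have "universe ?U"
  proof
    have "{{}} \<subseteq> range (\<lambda>_ :: 'k. {} :: 'k set)" by simp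
    then show "small ?U {pt ?U}" unfolding universe.simps by (rule smI)
    show "small ?U X \<Longrightarrow> Y \<subseteq> X \<Longrightarrow> small ?U Y" for X Y
      unfolding universe.simps sm_def by (meson order_trans)
    show "small ?U (h ` X)" if X: "small ?U X" for X h
    proof -
      obtain f :: "'k \<Rightarrow> 'k set" where "X \<subseteq> range f" using X by (auto simp: sm_def)
      then have "h ` X \<subseteq> range (h \<circ> f)" by auto
      then have "sm (h ` X)" by (rule smI)
      then show ?thesis by simp
    qed
    show "small ?U X \<Longrightarrow> small ?U Y \<Longrightarrow> small ?U (uprod ?U X Y)" for X Y
      by (simp add: uprod_def sm_pr)
    show "inj (pair ?U)" "inj_on (enc ?U) {X. small ?U X}" using inj_pr inj_en by simp_all
  qed
  moreover have "small ?U Z" if Z: "Z \<lesssim> (UNIV :: 'k set)" for Z :: "'k set set"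
  proof -
    obtain h :: "'k set \<Rightarrow> 'k" where "inj_on h Z" using Z by (auto simp: lepoll_def)
    then have "Z \<subseteq> range (inv_into Z h)" by (metis inv_into_f_f rangeI subsetI)
    then have "sm Z" by (rule smI)
    then show ?thesis by simp
  qed
  ultimately show ?thesis by blast
qed


section \<open>Subdistribution matrices\<close>

text \<open>
  A function on \<open>X\<close> (a matrix of shape \<open>(X, Y)\<close>) is represented by its extension by zero
  to the whole universe, so that equality of matrices of a given shape is HOL equality. All sums
  below have finitely many nonzero terms.
\<close>

type_synonym 'u matrix = "'u \<Rightarrow> 'u \<Rightarrow> real"

definition subdist :: "'u set \<Rightarrow> ('u \<Rightarrow> real) \<Rightarrow> bool" where
  "subdist X p \<longleftrightarrow> (\<forall>x\<in>X. p x \<in> {0..1}) \<and> (\<forall>x. x \<notin> X \<longrightarrow> p x = 0) \<and>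
     finite {x. p x \<noteq> 0} \<and> (\<Sum>\<^sub>\<infinity>x\<in>X. p x) \<le> 1"

definition subdist_mat :: "'u set \<Rightarrow> 'u set \<Rightarrow> 'u matrix \<Rightarrow> bool" where
  "subdist_mat X Y M \<longleftrightarrow> (\<forall>x\<in>X. subdist Y (M x)) \<and> (\<forall>x y. x \<notin> X \<longrightarrow> M x y = 0)"

definition mat_mult :: "'u set \<Rightarrow> 'u matrix \<Rightarrow> 'u matrix \<Rightarrow> 'u matrix" where
  "mat_mult Y M N = (\<lambda>x z. \<Sum>\<^sub>\<infinity>y\<in>Y. M x y * N y z)"

definition vec_mat :: "'u set \<Rightarrow> ('u \<Rightarrow> real) \<Rightarrow> 'u matrix \<Rightarrow> 'u \<Rightarrow> real" where
  "vec_mat X p M = (\<lambda>y. \<Sum>\<^sub>\<infinity>x\<in>X. p x * M x y)"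

definition id_mat :: "'u set \<Rightarrow> 'u matrix" where
  "id_mat X = (\<lambda>x y. of_bool (x \<in> X \<and> y = x))"

definition kron :: "'u universe \<Rightarrow> 'u matrix \<Rightarrow> 'u matrix \<Rightarrow> 'u matrix" where
  "kron U M N = (\<lambda>s t. if s \<in> range (pair U) \<and> t \<in> range (pair U)
     then (case (inv (pair U) s, inv (pair U) t) of ((x, u), (y, v)) \<Rightarrow> M x y * N u v)
     else 0)"

definition assoc_mat :: "'u universe \<Rightarrow> 'u set \<Rightarrow> 'u set \<Rightarrow> 'u set \<Rightarrow> 'u matrix" where
  "assoc_mat U X Y Z = (\<lambda>s t. of_bool (\<exists>x\<in>X. \<exists>y\<in>Y. \<exists>z\<in>Z.
     s = pair U (pair U (x, y), z) \<and> t = pair U (x, pair U (y, z))))"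

definition lunit_mat :: "'u universe \<Rightarrow> 'u set \<Rightarrow> 'u matrix" where
  "lunit_mat U X = (\<lambda>s t. of_bool (t \<in> X \<and> s = pair U (pt U, t)))"

definition runit_mat :: "'u universe \<Rightarrow> 'u set \<Rightarrow> 'u matrix" where
  "runit_mat U X = (\<lambda>s t. of_bool (t \<in> X \<and> s = pair U (t, pt U)))"

text \<open>An arrow is a triple of domain, codomain and matrix.\<close>

type_synonym ('o, 'u) mat_arr = "'o \<times> 'o \<times> 'u matrix"

definition subMat :: "'u universe \<Rightarrow> ('u set, ('u set, 'u) mat_arr) moncat" where
  "subMat U = \<lparr>
     Obj = {X. small U X},
     Arr = {(X, Y, M). small U X \<and> small U Y \<and> subdist_mat X Y M},
     Dom = (\<lambda>(X, Y, M). X),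
     Cod = (\<lambda>(X, Y, M). Y),
     Ident = (\<lambda>X. (X, X, id_mat X)),
     Comp = (\<lambda>(X, Y, M) (Y', Z, N). (X, Z, mat_mult Y M N)),
     TensorO = uprod U,
     TensorA = (\<lambda>(X, Y, M) (X', Y', N). (uprod U X X', uprod U Y Y', kron U M N)),
     UnitO = {pt U},
     Assoc = (\<lambda>X Y Z. (uprod U (uprod U X Y) Z, uprod U X (uprod U Y Z), assoc_mat U X Y Z)),
     LUnit = (\<lambda>X. (uprod U {pt U} X, X, lunit_mat U X)),
     RUnit = (\<lambda>X. (uprod U X {pt U}, X, runit_mat U X))\<rparr>"


section \<open>Partitioned sets and partitioned subdistribution matrices\<close>

type_synonym 'u pset = "'u set \<times> 'u rel"

definition pprod :: "'u universe \<Rightarrow> 'u pset \<Rightarrow> 'u pset \<Rightarrow> 'u pset" where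
  "pprod U = (\<lambda>(X, R) (Y, S). (uprod U X Y,
     {(pair U (x, y), pair U (x', y')) | x y x' y'. (x, x') \<in> R \<and> (y, y') \<in> S}))"

definition pone :: "'u universe \<Rightarrow> 'u pset" where
  "pone U = ({pt U}, {(pt U, pt U)})"

definition equiv_subdist :: "'u pset \<Rightarrow> ('u \<Rightarrow> real) \<Rightarrow> ('u \<Rightarrow> real) \<Rightarrow> bool" where
  "equiv_subdist = (\<lambda>(X, R) p q.
     \<forall>x\<in>X. (\<Sum>\<^sub>\<infinity>x'\<in>R `` {x}. p x') = (\<Sum>\<^sub>\<infinity>x'\<in>R `` {x}. q x'))"

definition partitioned :: "'u pset \<Rightarrow> 'u pset \<Rightarrow> 'u matrix \<Rightarrow> bool" where
  "partitioned A B M \<longleftrightarrow> (\<forall>p q. subdist (fst A) p \<longrightarrow> subdist (fst A) q \<longrightarrow>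
     equiv_subdist A p q \<longrightarrow>
     equiv_subdist B (vec_mat (fst A) p M) (vec_mat (fst A) q M))"

definition psets :: "'u universe \<Rightarrow> 'u pset set" where
  "psets U = {(X, R). small U X \<and> equiv X R}"

definition psubMat :: "'u universe \<Rightarrow> ('u pset, ('u pset, 'u) mat_arr) moncat" where
  "psubMat U = \<lparr>
     Obj = psets U,
     Arr = {(A, B, M). A \<in> psets U \<and> B \<in> psets U \<and>
       subdist_mat (fst A) (fst B) M \<and> partitioned A B M},
     Dom = (\<lambda>(A, B, M). A),
     Cod = (\<lambda>(A, B, M). B),
     Ident = (\<lambda>A. (A, A, id_mat (fst A))),
     Comp = (\<lambda>(A, B, M) (B', D, N). (A, D, mat_mult (fst B) M N)),
     TensorO = pprod U,
     TensorA = (\<lambda>(A, B, M) (A', B', N). (pprod U A A', pprod U B B', kron U M N)),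
     UnitO = pone U,
     Assoc = (\<lambda>A B D. (pprod U (pprod U A B) D, pprod U A (pprod U B D),
       assoc_mat U (fst A) (fst B) (fst D))),
     LUnit = (\<lambda>A. (pprod U (pone U) A, A, lunit_mat U (fst A))),
     RUnit = (\<lambda>A. (pprod U A (pone U), A, runit_mat U (fst A)))\<rparr>"


section \<open>Aggregation\<close>

definition cls :: "'u universe \<Rightarrow> 'u pset \<Rightarrow> 'u \<Rightarrow> 'u" where
  "cls U A x = enc U (snd A `` {x})"

definition Q_obj :: "'u universe \<Rightarrow> 'u pset \<Rightarrow> 'u set" where
  "Q_obj U A = enc U ` (fst A // snd A)"

text \<open>
  The entry at \<open>([x], [y])\<close> is the common value of the sum over all representatives \<open>x\<close>; that
  this value exists is part of the theorem.
\<close>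

definition Q_mat :: "'u universe \<Rightarrow> 'u pset \<Rightarrow> 'u pset \<Rightarrow> 'u matrix \<Rightarrow> 'u matrix" where
  "Q_mat U A B M = (\<lambda>c d. if c \<in> Q_obj U A \<and> d \<in> Q_obj U B
     then (THE r. \<forall>x\<in>fst A. \<forall>y\<in>fst B. c = cls U A x \<longrightarrow> d = cls U B y \<longrightarrow>
             r = (\<Sum>\<^sub>\<infinity>y'\<in>snd B `` {y}. M x y'))
     else 0)"

definition Q_arr :: "'u universe \<Rightarrow> ('u pset, 'u) mat_arr \<Rightarrow> ('u set, 'u) mat_arr" where
  "Q_arr U = (\<lambda>(A, B, M). (Q_obj U A, Q_obj U B, Q_mat U A B M))"

text \<open>
  The structure isomorphisms are the matrices of the canonical bijections \<open>([x], [y]) \<mapsto> [(x, y)]\<close>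
  from the product of the quotients to the quotient of the product, and \<open>pt \<mapsto> [pt]\<close>.
\<close>

definition Q_mult :: "'u universe \<Rightarrow> 'u pset \<Rightarrow> 'u pset \<Rightarrow> ('u set, 'u) mat_arr" where
  "Q_mult U A B = (uprod U (Q_obj U A) (Q_obj U B), Q_obj U (pprod U A B),
     \<lambda>s t. of_bool (\<exists>x\<in>fst A. \<exists>y\<in>fst B.
       s = pair U (cls U A x, cls U B y) \<and> t = cls U (pprod U A B) (pair U (x, y))))"

definition Q_unit :: "'u universe \<Rightarrow> ('u set, 'u) mat_arr" where
  "Q_unit U = ({pt U}, Q_obj U (pone U),
     \<lambda>s t. of_bool (s = pt U \<and> t = cls U (pone U) (pt U)))"

end

theory Submission
  imports Defs
begin

text \<open>
  Let \<open>\<pi>\<close> denote the matrix of the projection of a partitioned set onto its quotient. Two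
  subdistributions are equivalent iff they agree after multiplication by \<open>\<pi>\<close>, so a matrix \<open>M\<close> is
  partitioned iff \<open>M \<pi> = \<pi> N\<close> for some \<open>N\<close>; since \<open>\<pi>\<close> can be cancelled on the left, \<open>N\<close> is unique,
  and it is the aggregated matrix. Functoriality follows from uniqueness. Naturality of the structure
  maps says that the sum of a Kronecker product over a product of classes factorizes. All coherence
  isomorphisms are matrices of functions, which multiply by composing the functions, so that the
  coherence conditions can be checked on elements.
\<close>

section \<open>Subdistributions and their matrices\<close>

text \<open>Replaces a sum over a possibly infinite set by a finite one over any finite set
  containing the support. Double sums can then be exchanged as finite sums, without discussing
  summability.\<close>

lemma infsum_eq_sum:
  fixes f :: "'a \<Rightarrow> 'b::{comm_monoid_add, t2_space}"
  assumes "finite S" "S \<subseteq> X" "\<And>x. x \<in> X - S \<Longrightarrow> f x = 0"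
  shows "infsum f X = sum f S"
proof -
  have "infsum f X = infsum f S"
    by (rule infsum_cong_neutral) (use assms in auto)
  then show ?thesis
    using assms by simp
qed

lemma subdist_nonneg: "subdist X p \<Longrightarrow> 0 \<le> p x"
  unfolding subdist_def by (cases "x \<in> X") auto

lemma subdist_outside: "subdist X p \<Longrightarrow> x \<notin> X \<Longrightarrow> p x = 0"
  unfolding subdist_def by auto

lemma subdist_finite: "subdist X p \<Longrightarrow> finite {x. p x \<noteq> 0}"
  unfolding subdist_def by auto

lemma subdist_finite_on: "subdist X p \<Longrightarrow> finite {x \<in> Y. p x \<noteq> 0}"
  by (rule finite_subset[OF _ subdist_finite]) auto

text \<open>The definition bounds only the total over \<open>X\<close>. Enlarging \<open>T\<close>
  by the finite support can only increase the sum, and the enlarged sum equals that total;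
  \<open>T\<close> may reach outside \<open>X\<close>.\<close>

lemma subdist_sum_le_one:
  assumes "subdist X p" "finite T"
  shows "sum p T \<le> 1"
proof -
  let ?S = "{x. p x \<noteq> 0}"
  have "sum p T \<le> sum p (T \<union> ?S)"
    using assms subdist_nonneg[OF assms(1)] subdist_finite[OF assms(1)] by (intro sum_mono2) auto
  also have "\<dots> = sum p ?S"
    using assms(2) subdist_finite[OF assms(1)] by (intro sum.mono_neutral_right) auto
  also have "\<dots> = infsum p X"
    using subdist_finite[OF assms(1)] subdist_outside[OF assms(1)]
    by (intro infsum_eq_sum[symmetric]) auto
  also have "\<dots> \<le> 1"
    using assms(1) by (simp add: subdist_def)
  finally show ?thesis .
qed

text \<open>Each entry is at most the total, because the remaining entries are nonnegative. So a
  finite set containing the support and a bound on the sum over it suffice.\<close>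

lemma subdistI:
  assumes nonneg: "\<And>x. 0 \<le> p x" and T: "finite T" "T \<subseteq> X" "\<And>x. x \<notin> T \<Longrightarrow> p x = 0"
    and le: "sum p T \<le> 1"
  shows "subdist X p"
proof -
  have "p x \<le> 1" for x
  proof (cases "x \<in> T")
    case True
    then have "p x \<le> sum p T"
      using T(1) nonneg by (intro member_le_sum) auto
    with le show ?thesis by simp
  qed (use T in simp)
  moreover have "finite {x. p x \<noteq> 0}"
    by (rule finite_subset[OF _ T(1)]) (use T in auto)
  moreover have "infsum p X = sum p T"
    by (rule infsum_eq_sum) (use T in auto)
  ultimately show ?thesis
    unfolding subdist_def using nonneg T le by auto
qed

text \<open>The support of \<open>vec_mat X p M\<close> lies in the finite union of the supports of
  the rows that \<open>p\<close> charges. Exchanging the two finite sums turns the total mass into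
  the \<open>p\<close>-weighted sum of the row masses, each at most 1.\<close>

lemma subdist_vec_mat:
  assumes p: "subdist X p" and M: "subdist_mat X Y M"
  shows "subdist Y (vec_mat X p M)"
proof -
  define S where "S = {x. p x \<noteq> 0}"
  define T where "T = (\<Union>x\<in>S. {y. M x y \<noteq> 0})"
  have S: "finite S" "S \<subseteq> X"
    using subdist_finite[OF p] subdist_outside[OF p] by (auto simp: S_def)
  have row: "subdist Y (M x)" if "x \<in> S" for x
    using that S M by (auto simp: subdist_mat_def)
  have T: "finite T" "T \<subseteq> Y"
    using S subdist_finite[OF row] subdist_outside[OF row] by (auto simp: T_def)
  have eq: "vec_mat X p M y = (\<Sum>x\<in>S. p x * M x y)" for y
    unfolding vec_mat_def by (rule infsum_eq_sum) (use S in \<open>auto simp: S_def\<close>)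
  show ?thesis
  proof (rule subdistI[OF _ T])
    show "0 \<le> vec_mat X p M y" for y
      unfolding eq using subdist_nonneg[OF p] subdist_nonneg[OF row] by (simp add: sum_nonneg)
    show "vec_mat X p M y = 0" if "y \<notin> T" for y
      unfolding eq using that by (auto simp: T_def intro!: sum.neutral)
    have "sum (vec_mat X p M) T = (\<Sum>x\<in>S. p x * sum (M x) T)"
      unfolding eq sum_distrib_left by (rule sum.swap)
    also have "\<dots> \<le> (\<Sum>x\<in>S. p x * 1)"
      using subdist_nonneg[OF p] subdist_sum_le_one[OF row T(1)]
      by (intro sum_mono mult_left_mono) auto
    also have "\<dots> \<le> 1"
      using subdist_sum_le_one[OF p S(1)] by simp
    finally show "sum (vec_mat X p M) T \<le> 1" .
  qed
qed

text \<open>Finite supports reduce both sides to the same finite double sum. The vector form serves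
  twice: with a row of a matrix as \<open>p\<close> it gives associativity of
  \<open>mat_mult\<close>, and with a subdistribution as \<open>p\<close> it moves a factorization
  of \<open>M\<close> to \<open>vec_mat X p M\<close>.\<close>

lemma vec_mat_assoc:
  assumes p: "finite {x \<in> X. p x \<noteq> 0}" and M: "\<And>x. x \<in> X \<Longrightarrow> finite {y \<in> Y. M x y \<noteq> 0}"
  shows "vec_mat Y (vec_mat X p M) N = vec_mat X p (mat_mult Y M N)"
proof
  fix z
  define S where "S = {x \<in> X. p x \<noteq> 0}"
  define T where "T = (\<Union>x\<in>S. {y \<in> Y. M x y \<noteq> 0})"
  have S: "finite S" "S \<subseteq> X"
    using p by (auto simp: S_def)
  have T: "finite T" "T \<subseteq> Y"
    using S M by (auto simp: T_def)
  have eq: "vec_mat X p K y = (\<Sum>x\<in>S. p x * K x y)" for K :: "'a \<Rightarrow> 'a \<Rightarrow> real" and y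
    unfolding vec_mat_def by (rule infsum_eq_sum) (use S in \<open>auto simp: S_def\<close>)
  have inner: "mat_mult Y M N x z = (\<Sum>y\<in>T. M x y * N y z)" if "x \<in> S" for x
    unfolding mat_mult_def by (rule infsum_eq_sum) (use T that in \<open>auto simp: T_def\<close>)
  have "vec_mat Y (vec_mat X p M) N z = (\<Sum>y\<in>T. vec_mat X p M y * N y z)"
    unfolding vec_mat_def[of Y]
    by (rule infsum_eq_sum) (use T in \<open>auto simp: eq T_def sum.neutral\<close>)
  also have "\<dots> = (\<Sum>y\<in>T. \<Sum>x\<in>S. p x * (M x y * N y z))"
    by (simp add: eq sum_distrib_right mult.assoc)
  also have "\<dots> = (\<Sum>x\<in>S. \<Sum>y\<in>T. p x * (M x y * N y z))"
    by (rule sum.swap)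
  also have "\<dots> = vec_mat X p (mat_mult Y M N) z"
    by (simp add: eq inner sum_distrib_left)
  finally show "vec_mat Y (vec_mat X p M) N z = vec_mat X p (mat_mult Y M N) z" .
qed

lemma mat_mult_row: "mat_mult Y M N x = vec_mat Y (M x) N"
  by (simp add: mat_mult_def vec_mat_def)

lemma subdist_mat_row: "subdist_mat X Y M \<Longrightarrow> x \<in> X \<Longrightarrow> subdist Y (M x)"
  by (simp add: subdist_mat_def)

lemma subdist_mat_outside: "subdist_mat X Y M \<Longrightarrow> x \<notin> X \<or> y \<notin> Y \<Longrightarrow> M x y = 0"
  by (cases "x \<in> X") (auto simp: subdist_mat_def subdist_outside)

lemma subdist_mat_nonneg: "subdist_mat X Y M \<Longrightarrow> 0 \<le> M x y"
  by (cases "x \<in> X") (auto simp: subdist_mat_def subdist_nonneg)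

lemma subdist_mat_finite: "subdist_mat X Y M \<Longrightarrow> finite {y. M x y \<noteq> 0}"
  by (cases "x \<in> X") (auto simp: subdist_mat_def subdist_finite)

lemma subdist_mat_finite_on: "subdist_mat X Y M \<Longrightarrow> finite {y \<in> Z. M x y \<noteq> 0}"
  by (rule finite_subset[OF _ subdist_mat_finite]) auto

lemma subdist_mat_eqI:
  assumes "subdist_mat X Y M" "subdist_mat X Y N"
    and "\<And>x y. x \<in> X \<Longrightarrow> y \<in> Y \<Longrightarrow> M x y = N x y"
  shows "M = N"
proof (intro ext)
  show "M x y = N x y" for x y
    using assms(3) subdist_mat_outside[OF assms(1), of x y] subdist_mat_outside[OF assms(2), of x y]
    by (cases "x \<in> X \<and> y \<in> Y") auto
qed

lemma subdist_mat_mult: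
  assumes "subdist_mat X Y M" "subdist_mat Y Z N"
  shows "subdist_mat X Z (mat_mult Y M N)"
  unfolding subdist_mat_def
proof (intro conjI ballI allI impI)
  show "subdist Z (mat_mult Y M N x)" if "x \<in> X" for x
    unfolding mat_mult_row by (rule subdist_vec_mat[OF subdist_mat_row[OF assms(1) that] assms(2)])
  show "mat_mult Y M N x z = 0" if "x \<notin> X" for x z
    using subdist_mat_outside[OF assms(1)] that by (simp add: mat_mult_def)
qed

lemma mat_mult_assoc:
  assumes "subdist_mat X Y M" "subdist_mat Y Z N"
  shows "mat_mult Z (mat_mult Y M N) K = mat_mult Y M (mat_mult Z N K)"
proof
  show "mat_mult Z (mat_mult Y M N) K x = mat_mult Y M (mat_mult Z N K) x" for x
    unfolding mat_mult_row[of Z "mat_mult Y M N"] mat_mult_row[of Y M]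
    by (rule vec_mat_assoc) (rule subdist_mat_finite_on[OF assms(1)] subdist_mat_finite_on[OF assms(2)])+
qed


section \<open>Matrices of functions\<close>

text \<open>Row \<open>s\<close> is the point mass at \<open>f s\<close>. Identities, associators,
  unitors, quotient projections and the structure maps of the functor all have this form.\<close>

definition fun_mat :: "'u set \<Rightarrow> ('u \<Rightarrow> 'u) \<Rightarrow> 'u matrix" where
  "fun_mat X f = (\<lambda>s t. of_bool (s \<in> X \<and> t = f s))"

lemma id_mat_eq_fun_mat: "id_mat X = fun_mat X (\<lambda>x. x)"
  by (simp add: id_mat_def fun_mat_def)

lemma fun_mat_eq_iff: "fun_mat X f = fun_mat X g \<longleftrightarrow> (\<forall>x\<in>X. f x = g x)"
  by (auto simp: fun_mat_def fun_eq_iff)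

lemma subdist_mat_fun_mat:
  assumes "f \<in> X \<rightarrow> Y"
  shows "subdist_mat X Y (fun_mat X f)"
  unfolding subdist_mat_def
proof (intro conjI ballI allI impI)
  show "subdist Y (fun_mat X f x)" if "x \<in> X" for x
    by (rule subdistI[of _ "{f x}"]) (use that assms in \<open>auto simp: fun_mat_def\<close>)
qed (simp add: fun_mat_def)

lemma mat_mult_fun_mat_left:
  assumes "f \<in> X \<rightarrow> Y"
  shows "mat_mult Y (fun_mat X f) N = (\<lambda>x z. if x \<in> X then N (f x) z else 0)"
proof (intro ext)
  fix x z
  show "mat_mult Y (fun_mat X f) N x z = (if x \<in> X then N (f x) z else 0)"
  proof (cases "x \<in> X")
    case True
    have "mat_mult Y (fun_mat X f) N x z = (\<Sum>y\<in>{f x}. fun_mat X f x y * N y z)"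
      unfolding mat_mult_def
      by (rule infsum_eq_sum) (use True assms in \<open>auto simp: fun_mat_def\<close>)
    with True show ?thesis
      by (simp add: fun_mat_def)
  qed (simp add: mat_mult_def fun_mat_def)
qed

lemma mat_mult_fun_mat:
  assumes "f \<in> X \<rightarrow> Y"
  shows "mat_mult Y (fun_mat X f) (fun_mat Y g) = fun_mat X (\<lambda>x. g (f x))"
  unfolding mat_mult_fun_mat_left[OF assms] using assms
  by (auto simp: fun_mat_def fun_eq_iff)

text \<open>By injectivity \<open>y\<close> is the only element of \<open>Y\<close> over
  \<open>f y\<close>, so a single term survives. For a general \<open>f\<close> the entry is a sum
  over a fibre, which is how the quotient projection aggregates.\<close>

lemma mat_mult_fun_mat_right:
  assumes "inj_on f Y" "y \<in> Y"
  shows "mat_mult Y M (fun_mat Y f) x (f y) = M x y"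
proof -
  have "mat_mult Y M (fun_mat Y f) x (f y) = (\<Sum>y'\<in>{y}. M x y' * fun_mat Y f y' (f y))"
    unfolding mat_mult_def
    by (rule infsum_eq_sum) (use assms in \<open>auto simp: fun_mat_def dest: inj_onD\<close>)
  with assms show ?thesis
    by (simp add: fun_mat_def)
qed

text \<open>The common pattern of the naturality squares of associators, unitors and the
  multiplication of the functor. Since \<open>g\<close> is bijective, every column index is some
  \<open>g y\<close>; there the left side is \<open>M x y\<close> and the right side
  \<open>N (f x) (g y)\<close>, so only entries have to be compared.\<close>

lemma fun_mat_natural:
  assumes M: "subdist_mat X Y M" and N: "subdist_mat X' Y' N"
    and f: "f \<in> X \<rightarrow> X'" and g: "bij_betw g Y Y'"
    and eq: "\<And>x y. x \<in> X \<Longrightarrow> y \<in> Y \<Longrightarrow> M x y = N (f x) (g y)"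
  shows "mat_mult Y M (fun_mat Y g) = mat_mult X' (fun_mat X f) N"
proof (rule subdist_mat_eqI)
  have g': "g \<in> Y \<rightarrow> Y'"
    using g by (rule bij_betw_imp_funcset)
  show "subdist_mat X Y' (mat_mult Y M (fun_mat Y g))"
    by (rule subdist_mat_mult[OF M subdist_mat_fun_mat[OF g']])
  show "subdist_mat X Y' (mat_mult X' (fun_mat X f) N)"
    by (rule subdist_mat_mult[OF subdist_mat_fun_mat[OF f] N])
  fix x y' assume "x \<in> X" "y' \<in> Y'"
  moreover then obtain y where "y \<in> Y" "y' = g y"
    using g by (auto simp: bij_betw_def)
  ultimately show "mat_mult Y M (fun_mat Y g) x y' = mat_mult X' (fun_mat X f) N x y'"
    using g by (simp add: mat_mult_fun_mat_left[OF f] mat_mult_fun_mat_right bij_betw_def eq)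
qed

lemma mat_mult_id_left:
  assumes "subdist_mat X Y M"
  shows "mat_mult X (id_mat X) M = M"
  unfolding id_mat_eq_fun_mat
  by (subst mat_mult_fun_mat_left) (auto simp: fun_eq_iff subdist_mat_outside[OF assms])

lemma mat_mult_id_right:
  assumes "subdist_mat X Y M"
  shows "mat_mult Y M (id_mat Y) = M"
proof -
  \<comment> \<open>The naturality square with identity functions on both sides reduces the right
    unit law to the left one.\<close>
  have "mat_mult Y M (id_mat Y) = mat_mult X (id_mat X) M"
    unfolding id_mat_eq_fun_mat by (rule fun_mat_natural[OF assms assms]) (auto simp: bij_betw_def)
  then show ?thesis
    by (simp add: mat_mult_id_left[OF assms])
qed

lemma subdist_mat_id: "subdist_mat X X (id_mat X)"
  unfolding id_mat_eq_fun_mat by (rule subdist_mat_fun_mat) auto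

lemma mat_mult_fun_mat_inv:
  assumes "bij_betw f X Y"
  shows "mat_mult Y (fun_mat X f) (fun_mat Y (inv_into X f)) = id_mat X"
    and "mat_mult X (fun_mat Y (inv_into X f)) (fun_mat X f) = id_mat Y"
proof -
  have f: "f \<in> X \<rightarrow> Y" and g: "inv_into X f \<in> Y \<rightarrow> X"
    using assms bij_betw_inv_into[OF assms] by (simp_all only: bij_betw_imp_funcset)
  show "mat_mult Y (fun_mat X f) (fun_mat Y (inv_into X f)) = id_mat X"
    unfolding id_mat_eq_fun_mat mat_mult_fun_mat[OF f]
    by (simp add: fun_mat_eq_iff bij_betw_inv_into_left[OF assms])
  show "mat_mult X (fun_mat Y (inv_into X f)) (fun_mat X f) = id_mat Y"
    unfolding id_mat_eq_fun_mat mat_mult_fun_mat[OF g]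
    by (simp add: fun_mat_eq_iff bij_betw_inv_into_right[OF assms])
qed


section \<open>Kronecker products\<close>

text \<open>The value is arbitrary outside the coded pairs. This is harmless, since the matrices of
  functions built from the projections have coded pairs as row indices.\<close>

definition ufst :: "'u universe \<Rightarrow> 'u \<Rightarrow> 'u" where
  "ufst U s = fst (inv (pair U) s)"

definition usnd :: "'u universe \<Rightarrow> 'u \<Rightarrow> 'u" where
  "usnd U s = snd (inv (pair U) s)"

definition umap :: "'u universe \<Rightarrow> ('u \<Rightarrow> 'u) \<Rightarrow> ('u \<Rightarrow> 'u) \<Rightarrow> 'u \<Rightarrow> 'u" where
  "umap U f g s = pair U (f (ufst U s), g (usnd U s))"

definition uassoc :: "'u universe \<Rightarrow> 'u \<Rightarrow> 'u" where
  "uassoc U s = pair U (ufst U (ufst U s), pair U (usnd U (ufst U s), usnd U s))"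

lemma uprodE:
  assumes "s \<in> uprod U X Y"
  obtains x y where "s = pair U (x, y)" "x \<in> X" "y \<in> Y"
  using assms by (auto simp: uprod_def)

context universe
begin

lemma pair_eq_iff [simp]: "pair U s = pair U t \<longleftrightarrow> s = t"
  by (rule inj_eq[OF inj_pair])

lemma ufst_pair [simp]: "ufst U (pair U (x, y)) = x"
  by (simp add: ufst_def inv_f_f[OF inj_pair])

lemma usnd_pair [simp]: "usnd U (pair U (x, y)) = y"
  by (simp add: usnd_def inv_f_f[OF inj_pair])

lemma umap_pair [simp]: "umap U f g (pair U (x, y)) = pair U (f x, g y)"
  by (simp add: umap_def)

lemma uassoc_pair [simp]: "uassoc U (pair U (pair U (x, y), z)) = pair U (x, pair U (y, z))"
  by (simp add: uassoc_def)

lemma pair_mem_uprod [simp]: "pair U (x, y) \<in> uprod U X Y \<longleftrightarrow> x \<in> X \<and> y \<in> Y"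
  by (auto simp: uprod_def)

lemma kron_pair [simp]: "kron U M N (pair U (x, u)) (pair U (y, v)) = M x y * N u v"
  by (simp add: kron_def inv_f_f[OF inj_pair])

lemma ball_uprod [simp]: "(\<forall>s\<in>uprod U X Y. P s) \<longleftrightarrow> (\<forall>x\<in>X. \<forall>y\<in>Y. P (pair U (x, y)))"
  by (auto simp: uprod_def)

text \<open>Reindexing along the injective pairing and restricting to the product of the finite
  supports leaves the distributive law. Row masses, products and class sums of Kronecker products
  are all computed from this.\<close>

lemma infsum_uprod:
  fixes f g h :: "'u \<Rightarrow> real"
  assumes f: "finite {x \<in> X. f x \<noteq> 0}" and g: "finite {y \<in> Y. g y \<noteq> 0}"
    and h: "\<And>x y. x \<in> X \<Longrightarrow> y \<in> Y \<Longrightarrow> h (pair U (x, y)) = f x * g y"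
  shows "infsum h (uprod U X Y) = infsum f X * infsum g Y"
proof -
  let ?S = "{x \<in> X. f x \<noteq> 0}" and ?T = "{y \<in> Y. g y \<noteq> 0}"
  have "infsum h (uprod U X Y) = infsum (h \<circ> pair U) (X \<times> Y)"
    unfolding uprod_def by (rule infsum_reindex) (use inj_pair in \<open>auto intro: inj_on_subset\<close>)
  also have "\<dots> = sum (h \<circ> pair U) (?S \<times> ?T)"
    by (rule infsum_eq_sum) (use f g h in auto)
  also have "\<dots> = (\<Sum>(x, y)\<in>?S \<times> ?T. f x * g y)"
    by (rule sum.cong) (auto simp: h)
  also have "\<dots> = sum f ?S * sum g ?T"
    by (simp add: sum_product sum.cartesian_product)
  also have "sum f ?S = infsum f X"
    by (rule infsum_eq_sum[symmetric]) (use f in auto)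
  also have "sum g ?T = infsum g Y"
    by (rule infsum_eq_sum[symmetric]) (use g in auto)
  finally show ?thesis .
qed

text \<open>On coded pairs \<open>kron\<close> is defined whatever the components are. The zeros
  outside the products come from the factors: one of them is evaluated outside its own
  shape.\<close>

lemma kron_outside:
  assumes "subdist_mat X Y M" "subdist_mat X' Y' N" "s \<notin> uprod U X X' \<or> t \<notin> uprod U Y Y'"
  shows "kron U M N s t = 0"
proof (cases "s \<in> range (pair U) \<and> t \<in> range (pair U)")
  case True
  then obtain x u y v where "s = pair U (x, u)" "t = pair U (y, v)"
    by auto
  then show ?thesis
    using assms(3) subdist_mat_outside[OF assms(1), of x y] subdist_mat_outside[OF assms(2), of u v]
    by auto
qed (auto simp: kron_def)

lemma subdist_mat_kron:
  assumes M: "subdist_mat X Y M" and N: "subdist_mat X' Y' N"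
  shows "subdist_mat (uprod U X X') (uprod U Y Y') (kron U M N)"
  unfolding subdist_mat_def
proof (intro conjI ballI allI impI)
  fix s assume "s \<in> uprod U X X'"
  then obtain x u where s: "s = pair U (x, u)" "x \<in> X" "u \<in> X'"
    by (rule uprodE)
  let ?S = "{y. M x y \<noteq> 0}" and ?T = "{v. N u v \<noteq> 0}"
  have fin: "finite ?S" "finite ?T"
    using M N by (auto intro: subdist_mat_finite)
  have sub: "?S \<subseteq> Y" "?T \<subseteq> Y'"
    using subdist_mat_outside[OF M] subdist_mat_outside[OF N] by auto
  show "subdist (uprod U Y Y') (kron U M N s)"
  proof (rule subdistI)
    show "0 \<le> kron U M N s t" for t
      using subdist_mat_nonneg[OF M] subdist_mat_nonneg[OF N]
      by (auto simp: kron_def split: prod.split)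
    show "finite (uprod U ?S ?T)"
      using fin by (simp add: uprod_def)
    show "uprod U ?S ?T \<subseteq> uprod U Y Y'"
      using sub by (auto simp: uprod_def)
    show "kron U M N s t = 0" if "t \<notin> uprod U ?S ?T" for t
    proof (cases "t \<in> range (pair U)")
      case True
      then obtain y v where "t = pair U (y, v)" by auto
      with that s show ?thesis by auto
    qed (simp add: kron_def)
    \<comment> \<open>The finite sum is read as an infinite one so that it factorizes into the two
      row masses.\<close>
    have "sum (kron U M N s) (uprod U ?S ?T) = infsum (kron U M N s) (uprod U ?S ?T)"
      using fin by (simp add: uprod_def)
    also have "\<dots> = infsum (M x) ?S * infsum (N u) ?T"
      by (rule infsum_uprod) (use fin s in auto)
    also have "\<dots> = sum (M x) ?S * sum (N u) ?T"
      using fin by simp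
    also have "\<dots> \<le> 1 * 1"
      using subdist_sum_le_one[OF subdist_mat_row[OF M s(2)] fin(1)]
        subdist_sum_le_one[OF subdist_mat_row[OF N s(3)] fin(2)]
      by (intro mult_mono sum_nonneg subdist_mat_nonneg[OF M] subdist_mat_nonneg[OF N]) auto
    finally show "sum (kron U M N s) (uprod U ?S ?T) \<le> 1" by simp
  qed
qed (use kron_outside[OF M N] in auto)

text \<open>For fixed outer indices the summand at an inner pair is a function of its first
  component times a function of its second, so the sum over pairs splits.\<close>

lemma kron_mat_mult:
  assumes M: "subdist_mat X Y M" and M': "subdist_mat Y Z M'"
    and N: "subdist_mat X' Y' N" and N': "subdist_mat Y' Z' N'"
  shows "kron U (mat_mult Y M M') (mat_mult Y' N N')
    = mat_mult (uprod U Y Y') (kron U M N) (kron U M' N')"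
proof (rule subdist_mat_eqI)
  show "subdist_mat (uprod U X X') (uprod U Z Z') (kron U (mat_mult Y M M') (mat_mult Y' N N'))"
    by (intro subdist_mat_kron subdist_mat_mult assms)
  show "subdist_mat (uprod U X X') (uprod U Z Z')
      (mat_mult (uprod U Y Y') (kron U M N) (kron U M' N'))"
    by (intro subdist_mat_mult[OF subdist_mat_kron subdist_mat_kron] assms)
  fix s t assume "s \<in> uprod U X X'" "t \<in> uprod U Z Z'"
  then obtain x u z w where st: "s = pair U (x, u)" "t = pair U (z, w)"
    by (auto elim!: uprodE)
  have "mat_mult (uprod U Y Y') (kron U M N) (kron U M' N') s t
      = mat_mult Y M M' x z * mat_mult Y' N N' u w"
    unfolding mat_mult_def
    by (rule infsum_uprod)
      (auto simp: st intro: finite_subset[OF _ subdist_mat_finite[OF M]]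
        finite_subset[OF _ subdist_mat_finite[OF N]])
  then show "kron U (mat_mult Y M M') (mat_mult Y' N N') s t
      = mat_mult (uprod U Y Y') (kron U M N) (kron U M' N') s t"
    by (simp add: st)
qed

section \<open>Structure isomorphisms as matrices of bijections\<close>

lemma ufst_funcset: "ufst U \<in> uprod U X Y \<rightarrow> X"
  by (auto elim!: uprodE)

lemma usnd_funcset: "usnd U \<in> uprod U X Y \<rightarrow> Y"
  by (auto elim!: uprodE)

lemma kron_fun_mat:
  "kron U (fun_mat X f) (fun_mat Y g) = fun_mat (uprod U X Y) (umap U f g)"
proof (intro ext)
  fix s t
  show "kron U (fun_mat X f) (fun_mat Y g) s t = fun_mat (uprod U X Y) (umap U f g) s t"
  proof (cases "s \<in> range (pair U) \<and> t \<in> range (pair U)")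
    case True
    then obtain x u y v where "s = pair U (x, u)" "t = pair U (y, v)"
      by auto
    then show ?thesis
      by (auto simp: fun_mat_def)
  next
    case False
    \<comment> \<open>Both \<open>uprod U X Y\<close> and the values of \<open>umap U f g\<close>
      consist of coded pairs, so the right-hand entry is zero exactly as \<open>kron\<close> is by
      default.\<close>
    then have "\<not> (s \<in> uprod U X Y \<and> t = umap U f g s)"
      by (auto simp: uprod_def umap_def)
    with False show ?thesis
      by (auto simp: kron_def fun_mat_def)
  qed
qed

lemma kron_id: "kron U (id_mat X) (id_mat Y) = id_mat (uprod U X Y)"
  unfolding id_mat_eq_fun_mat kron_fun_mat by (simp add: fun_mat_eq_iff)

lemma assoc_mat_eq_fun_mat:
  "assoc_mat U X Y Z = fun_mat (uprod U (uprod U X Y) Z) (uassoc U)"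
  unfolding assoc_mat_def fun_mat_def
  by (intro ext arg_cong[of _ _ of_bool]) (fastforce elim!: uprodE)

lemma lunit_mat_eq_fun_mat: "lunit_mat U X = fun_mat (uprod U {pt U} X) (usnd U)"
  unfolding lunit_mat_def fun_mat_def
  by (intro ext arg_cong[of _ _ of_bool]) (auto elim!: uprodE)

lemma runit_mat_eq_fun_mat: "runit_mat U X = fun_mat (uprod U X {pt U}) (ufst U)"
  unfolding runit_mat_def fun_mat_def
  by (intro ext arg_cong[of _ _ of_bool]) (auto elim!: uprodE)

lemma bij_betw_uassoc: "bij_betw (uassoc U) (uprod U (uprod U X Y) Z) (uprod U X (uprod U Y Z))"
  by (rule bij_betwI[where g = "\<lambda>s. pair U (pair U (ufst U s, ufst U (usnd U s)), usnd U (usnd U s))"])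
    (auto elim!: uprodE)

lemma bij_betw_usnd: "bij_betw (usnd U) (uprod U {pt U} X) X"
  by (rule bij_betwI[where g = "\<lambda>x. pair U (pt U, x)"]) (auto elim!: uprodE)

lemma bij_betw_ufst: "bij_betw (ufst U) (uprod U X {pt U}) X"
  by (rule bij_betwI[where g = "\<lambda>x. pair U (x, pt U)"]) (auto elim!: uprodE)

section \<open>Naturality and coherence for matrices\<close>

lemma assoc_mat_natural:
  assumes "subdist_mat X X' M" "subdist_mat Y Y' N" "subdist_mat Z Z' K"
  shows "mat_mult (uprod U (uprod U X' Y') Z') (kron U (kron U M N) K) (assoc_mat U X' Y' Z')
    = mat_mult (uprod U X (uprod U Y Z)) (assoc_mat U X Y Z) (kron U M (kron U N K))"
  unfolding assoc_mat_eq_fun_mat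
  by (rule fun_mat_natural)
    (auto intro!: subdist_mat_kron assms bij_betw_uassoc elim!: uprodE)

lemma lunit_mat_natural:
  assumes "subdist_mat X Y M"
  shows "mat_mult (uprod U {pt U} Y) (kron U (id_mat {pt U}) M) (lunit_mat U Y)
    = mat_mult X (lunit_mat U X) M"
  unfolding lunit_mat_eq_fun_mat
  by (rule fun_mat_natural[OF subdist_mat_kron[OF subdist_mat_id assms] assms usnd_funcset bij_betw_usnd])
    (auto simp: id_mat_def elim!: uprodE)

lemma runit_mat_natural:
  assumes "subdist_mat X Y M"
  shows "mat_mult (uprod U Y {pt U}) (kron U M (id_mat {pt U})) (runit_mat U Y)
    = mat_mult X (runit_mat U X) M"
  unfolding runit_mat_eq_fun_mat
  by (rule fun_mat_natural[OF subdist_mat_kron[OF assms subdist_mat_id] assms ufst_funcset bij_betw_ufst])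
    (auto simp: id_mat_def elim!: uprodE)

text \<open>Every factor is the matrix of a function, so both sides are too; evaluated at (((x, y),
  z), w), both functions give (x, (y, (z, w))).\<close>

lemma mat_pentagon:
  "mat_mult (uprod U (uprod U X Y) (uprod U Z W))
      (assoc_mat U (uprod U X Y) Z W) (assoc_mat U X Y (uprod U Z W))
    = mat_mult (uprod U X (uprod U (uprod U Y Z) W))
        (mat_mult (uprod U (uprod U X (uprod U Y Z)) W)
          (kron U (assoc_mat U X Y Z) (id_mat W)) (assoc_mat U X (uprod U Y Z) W))
        (kron U (id_mat X) (assoc_mat U Y Z W))"
  by (simp add: assoc_mat_eq_fun_mat id_mat_eq_fun_mat kron_fun_mat mat_mult_fun_mat Pi_iff
      fun_mat_eq_iff)

lemma mat_triangle:
  "mat_mult (uprod U X (uprod U {pt U} Y)) (assoc_mat U X {pt U} Y) (kron U (id_mat X) (lunit_mat U Y))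
    = kron U (runit_mat U X) (id_mat Y)"
  by (simp add: assoc_mat_eq_fun_mat lunit_mat_eq_fun_mat runit_mat_eq_fun_mat id_mat_eq_fun_mat
      kron_fun_mat mat_mult_fun_mat Pi_iff fun_mat_eq_iff)


section \<open>The monoidal category of subdistribution matrices\<close>

lemma subMat_simps [simp]:
  "Obj (subMat U) = {X. small U X}"
  "Ident (subMat U) X = (X, X, id_mat X)"
  "Comp (subMat U) (X, Y, M) (Y', Z, N) = (X, Z, mat_mult Y M N)"
  "TensorO (subMat U) = uprod U"
  "TensorA (subMat U) (X, Y, M) (X', Y', N) = (uprod U X X', uprod U Y Y', kron U M N)"
  "UnitO (subMat U) = {pt U}"
  "Assoc (subMat U) X Y Z = (uprod U (uprod U X Y) Z, uprod U X (uprod U Y Z), assoc_mat U X Y Z)"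
  "LUnit (subMat U) X = (uprod U {pt U} X, X, lunit_mat U X)"
  "RUnit (subMat U) X = (uprod U X {pt U}, X, runit_mat U X)"
  by (simp_all add: subMat_def)

lemma hom_subMat:
  "hom (subMat U) X Y
    = {f. \<exists>M. f = (X, Y, M) \<and> small U X \<and> small U Y \<and> subdist_mat X Y M}"
  by (auto simp: hom_def subMat_def)

lemma is_iso_subMat:
  assumes "small U X" "small U Y" "bij_betw f X Y"
  shows "is_iso (subMat U) X Y (X, Y, fun_mat X f)"
  unfolding is_iso_def
proof (intro conjI bexI)
  show "(X, Y, fun_mat X f) \<in> hom (subMat U) X Y"
    using assms by (simp add: hom_subMat subdist_mat_fun_mat bij_betw_imp_funcset)
  show "(Y, X, fun_mat Y (inv_into X f)) \<in> hom (subMat U) Y X"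
    using assms bij_betw_inv_into[OF assms(3)]
    by (simp add: hom_subMat subdist_mat_fun_mat bij_betw_imp_funcset)
qed (simp_all add: mat_mult_fun_mat_inv[OF assms(3)])

lemma category_subMat: "category (subMat U)"
proof
  show "f \<in> Arr (subMat U) \<Longrightarrow> Dom (subMat U) f \<in> Obj (subMat U)"
    "f \<in> Arr (subMat U) \<Longrightarrow> Cod (subMat U) f \<in> Obj (subMat U)" for f
    by (auto simp: subMat_def)
qed (auto simp: hom_subMat subdist_mat_id mat_mult_id_left mat_mult_id_right mat_mult_assoc
    intro: subdist_mat_mult)

lemma is_iso_structure_subMat:
  assumes "small U X" "small U Y" "small U Z"
  shows "is_iso (subMat U) (uprod U (uprod U X Y) Z) (uprod U X (uprod U Y Z)) (Assoc (subMat U) X Y Z)"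
    and "is_iso (subMat U) (uprod U {pt U} X) X (LUnit (subMat U) X)"
    and "is_iso (subMat U) (uprod U X {pt U}) X (RUnit (subMat U) X)"
  using assms
  by (auto simp: assoc_mat_eq_fun_mat lunit_mat_eq_fun_mat runit_mat_eq_fun_mat
      intro!: is_iso_subMat small_prod small_one bij_betw_uassoc bij_betw_usnd bij_betw_ufst)

lemma monoidal_category_subMat: "monoidal_category (subMat U)"
  unfolding monoidal_category_def monoidal_category_axioms_def
  using is_iso_structure_subMat
  by (auto simp: category_subMat hom_subMat small_prod small_one subdist_mat_kron kron_id
      kron_mat_mult assoc_mat_natural lunit_mat_natural runit_mat_natural mat_pentagon mat_triangle)


section \<open>Partitioned sets\<close>

lemma mem_psets: "A \<in> psets U \<longleftrightarrow> small U (fst A) \<and> equiv (fst A) (snd A)"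
  by (cases A) (simp add: psets_def)

lemma fst_pprod [simp]: "fst (pprod U A B) = uprod U (fst A) (fst B)"
  by (simp add: pprod_def split: prod.split)

lemma fst_pone [simp]: "fst (pone U) = {pt U}"
  by (simp add: pone_def)

lemma snd_pone [simp]: "snd (pone U) = {(pt U, pt U)}"
  by (simp add: pone_def)

lemma pair_mem_pprod [simp]:
  "(pair U (x, y), pair U (x', y')) \<in> snd (pprod U A B) \<longleftrightarrow> (x, x') \<in> snd A \<and> (y, y') \<in> snd B"
  by (auto simp: pprod_def split: prod.split)

lemma pprod_relE:
  assumes "(s, t) \<in> snd (pprod U A B)"
  obtains x y x' y' where "s = pair U (x, y)" "t = pair U (x', y')"
    "(x, x') \<in> snd A" "(y, y') \<in> snd B"
  using assms by (auto simp: pprod_def split: prod.splits)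

text \<open>The reason why aggregation respects tensor products: sums over classes of the product
  become sums over products of classes.\<close>

lemma pprod_class: "snd (pprod U A B) `` {pair U (x, y)} = uprod U (snd A `` {x}) (snd B `` {y})"
  by (auto elim!: pprod_relE uprodE)

lemma psets_rel_mem:
  assumes "A \<in> psets U" "(x, x') \<in> snd A"
  shows "x \<in> fst A" "x' \<in> fst A"
  using assms by (auto simp: mem_psets equiv_def refl_on_def)

lemma pprod_psets:
  assumes A: "A \<in> psets U" and B: "B \<in> psets U"
  shows "pprod U A B \<in> psets U"
  unfolding mem_psets
proof (intro conjI equivI)
  note eq = A[unfolded mem_psets, THEN conjunct2] B[unfolded mem_psets, THEN conjunct2]
  show "small U (fst (pprod U A B))"
    using A B by (simp add: mem_psets small_prod)
  show "snd (pprod U A B) \<subseteq> fst (pprod U A B) \<times> fst (pprod U A B)"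
    using psets_rel_mem[OF A] psets_rel_mem[OF B] by (auto elim!: pprod_relE)
  show "refl_on (fst (pprod U A B)) (snd (pprod U A B))"
    using eq by (auto simp: equiv_def refl_on_def elim!: uprodE)
  show "sym (snd (pprod U A B))"
    using eq by (auto simp: equiv_def intro!: symI elim!: pprod_relE dest: symD)
  show "trans (snd (pprod U A B))"
    using eq by (auto simp: equiv_def intro!: transI elim!: pprod_relE dest: transD)
qed

lemma pone_psets: "pone U \<in> psets U"
  by (auto simp: mem_psets small_one equiv_def refl_on_def sym_def trans_def)

text \<open>Classes are subsets of a small set, hence small, and \<open>enc U\<close> is injective
  on small sets. So codes of classes distinguish exactly what the classes do.\<close>

lemma cls_eq_iff:
  assumes "A \<in> psets U" "x \<in> fst A" "y \<in> fst A"
  shows "cls U A x = cls U A y \<longleftrightarrow> (x, y) \<in> snd A"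
proof -
  have eq: "equiv (fst A) (snd A)"
    using assms by (simp add: mem_psets)
  have "snd A `` {z} \<subseteq> fst A" for z
    using psets_rel_mem[OF assms(1)] by auto
  then have "small U (snd A `` {z})" for z
    using assms(1) small_subset by (auto simp: mem_psets)
  then have "cls U A x = cls U A y \<longleftrightarrow> snd A `` {x} = snd A `` {y}"
    unfolding cls_def by (intro inj_on_eq_iff[OF inj_enc]) auto
  also have "\<dots> \<longleftrightarrow> (x, y) \<in> snd A"
    using eq_equiv_class_iff[OF eq assms(2,3)] .
  finally show ?thesis .
qed

lemma Q_obj_eq: "Q_obj U A = cls U A ` fst A"
  by (auto simp: Q_obj_def cls_def quotient_def)

lemma small_Q_obj: "A \<in> psets U \<Longrightarrow> small U (Q_obj U A)"
  by (simp add: Q_obj_eq mem_psets small_image)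

lemma cls_mem_Q_obj: "x \<in> fst A \<Longrightarrow> cls U A x \<in> Q_obj U A"
  by (simp add: Q_obj_eq)

lemma ball_Q_obj: "(\<forall>c\<in>Q_obj U A. P c) \<longleftrightarrow> (\<forall>x\<in>fst A. P (cls U A x))"
  by (simp add: Q_obj_eq)

lemma cls_funcset: "cls U A \<in> fst A \<rightarrow> Q_obj U A"
  by (simp add: Q_obj_eq)


section \<open>Aggregation as a factorization through the quotient\<close>

abbreviation proj :: "'u pset \<Rightarrow> 'u matrix" where
  "proj A \<equiv> fun_mat (fst A) (cls U A)"

lemma subdist_mat_proj: "subdist_mat (fst A) (Q_obj U A) (proj A)"
  by (rule subdist_mat_fun_mat[OF cls_funcset])

text \<open>The column of \<open>proj A\<close> at \<open>cls U A x\<close> is the indicator of the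
  class of \<open>x\<close>.\<close>

lemma vec_mat_proj:
  assumes "A \<in> psets U" "x \<in> fst A"
  shows "vec_mat (fst A) p (proj A) (cls U A x) = infsum p (snd A `` {x})"
  unfolding vec_mat_def
  by (rule infsum_cong_neutral)
    (use assms psets_rel_mem[OF assms(1)] in \<open>auto simp: fun_mat_def cls_eq_iff\<close>)

lemma vec_mat_proj_outside:
  assumes "d \<notin> Q_obj U A"
  shows "vec_mat (fst A) p (proj A) d = 0"
  unfolding vec_mat_def using assms by (auto simp: fun_mat_def Q_obj_eq intro!: infsum_0)

text \<open>Turns the family of conditions on class sums into one equation of vectors, to which
  matrix algebra applies. Indices that are not codes of classes contribute zero on both
  sides.\<close>

lemma equiv_subdist_iff:
  assumes "A \<in> psets U"
  shows "equiv_subdist A p q \<longleftrightarrow> vec_mat (fst A) p (proj A) = vec_mat (fst A) q (proj A)"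
proof -
  have "equiv_subdist A p q \<longleftrightarrow>
      (\<forall>d\<in>Q_obj U A. vec_mat (fst A) p (proj A) d = vec_mat (fst A) q (proj A) d)"
    by (cases A) (use vec_mat_proj[OF assms] in \<open>simp add: equiv_subdist_def Q_obj_eq\<close>)
  also have "\<dots> \<longleftrightarrow> vec_mat (fst A) p (proj A) = vec_mat (fst A) q (proj A)"
    unfolding fun_eq_iff using vec_mat_proj_outside by metis
  finally show ?thesis .
qed

text \<open>The lumpability condition known from Markov chains. It speaks only of rows, which makes
  it easier to check and to use than the quantification over all subdistributions in
  \<open>partitioned\<close>.\<close>

definition lumpable :: "'u pset \<Rightarrow> 'u pset \<Rightarrow> 'u matrix \<Rightarrow> bool" where
  "lumpable A B M \<longleftrightarrow> (\<forall>(x, x')\<in>snd A. equiv_subdist B (M x) (M x'))"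

text \<open>Point masses at related points are equivalent and are mapped to the rows of the matrix.\<close>

lemma partitioned_imp_lumpable:
  assumes A: "A \<in> psets U" and M: "subdist_mat (fst A) Y M" and part: "partitioned A B M"
  shows "lumpable A B M"
  unfolding lumpable_def
proof clarify
  fix x x' assume rel: "(x, x') \<in> snd A"
  note mem = psets_rel_mem[OF A rel]
  let ?\<delta> = "id_mat (fst A)"
  \<comment> \<open>The point mass at \<open>z\<close> is row \<open>z\<close> of the identity
    matrix, so this is one row of the left unit law.\<close>
  have vec: "vec_mat (fst A) (?\<delta> z) N = N z" if "subdist_mat (fst A) Z N" for z Z N
    using mat_mult_id_left[OF that] by (simp flip: mat_mult_row)
  have "proj A x = proj A x'"
    using cls_eq_iff[OF A mem] rel mem by (simp add: fun_mat_def)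
  then have "equiv_subdist A (?\<delta> x) (?\<delta> x')"
    by (simp add: equiv_subdist_iff[OF A] vec[OF subdist_mat_proj])
  then have "equiv_subdist B (vec_mat (fst A) (?\<delta> x) M) (vec_mat (fst A) (?\<delta> x') M)"
    using part subdist_mat_row[OF subdist_mat_id mem(1)] subdist_mat_row[OF subdist_mat_id mem(2)]
    by (auto simp: partitioned_def)
  then show "equiv_subdist B (M x) (M x')"
    by (simp add: vec[OF M])
qed

text \<open>Well-definedness of the aggregated matrix: replacing \<open>y\<close> by a related
  element keeps the index set, and replacing \<open>x\<close> keeps the sum by lumpability. As
  \<open>x\<close> and \<open>y\<close> are themselves representatives, the definite description has
  exactly one solution.\<close>

lemma Q_mat_cls:
  assumes A: "A \<in> psets U" and B: "B \<in> psets U" and lump: "lumpable A B M"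
    and x: "x \<in> fst A" and y: "y \<in> fst B"
  shows "Q_mat U A B M (cls U A x) (cls U B y) = infsum (M x) (snd B `` {y})"
proof -
  have "infsum (M x) (snd B `` {y}) = infsum (M x') (snd B `` {y'})"
    if x': "x' \<in> fst A" "cls U A x = cls U A x'" and y': "y' \<in> fst B" "cls U B y = cls U B y'"
    for x' y'
  proof -
    have "(x, x') \<in> snd A"
      using x x' by (simp add: cls_eq_iff[OF A])
    then have "equiv_subdist B (M x) (M x')"
      using lump by (auto simp: lumpable_def)
    then show ?thesis
      using vec_mat_proj[OF B y] vec_mat_proj[OF B y'(1)] y'(2)
      by (metis equiv_subdist_iff[OF B])
  qed
  then have "(THE r. \<forall>x'\<in>fst A. \<forall>y'\<in>fst B. cls U A x = cls U A x' \<longrightarrow> cls U B y = cls U B y' \<longrightarrow>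
      r = infsum (M x') (snd B `` {y'})) = infsum (M x) (snd B `` {y})"
    using x y by (intro the_equality) blast+
  moreover have "cls U A x \<in> Q_obj U A" "cls U B y \<in> Q_obj U B"
    using x y by (auto simp: Q_obj_eq)
  ultimately show ?thesis
    by (simp add: Q_mat_def)
qed

lemma Q_mat_row:
  assumes "A \<in> psets U" "B \<in> psets U" "lumpable A B M" "x \<in> fst A"
  shows "Q_mat U A B M (cls U A x) = mat_mult (fst B) M (proj B) x"
proof
  fix d
  show "Q_mat U A B M (cls U A x) d = mat_mult (fst B) M (proj B) x d"
  proof (cases "d \<in> Q_obj U B")
    case True
    then obtain y where "y \<in> fst B" "d = cls U B y"
      by (auto simp: Q_obj_eq)
    then show ?thesis
      using assms by (simp add: Q_mat_cls mat_mult_row vec_mat_proj)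
  next
    case False
    then show ?thesis
      by (simp add: mat_mult_row vec_mat_proj_outside) (simp add: Q_mat_def)
  qed
qed

lemma subdist_mat_Q_mat:
  assumes "A \<in> psets U" "B \<in> psets U" "lumpable A B M" "subdist_mat (fst A) (fst B) M"
  shows "subdist_mat (Q_obj U A) (Q_obj U B) (Q_mat U A B M)"
  unfolding subdist_mat_def
proof (intro conjI ballI allI impI)
  fix c assume "c \<in> Q_obj U A"
  then obtain x where "x \<in> fst A" "c = cls U A x"
    by (auto simp: Q_obj_eq)
  then show "subdist (Q_obj U B) (Q_mat U A B M c)"
    using Q_mat_row[OF assms(1-3)] subdist_mat_mult[OF assms(4) subdist_mat_proj]
    by (simp add: subdist_mat_row)
qed (simp add: Q_mat_def)

lemma proj_Q_mat:
  assumes "A \<in> psets U" "B \<in> psets U" "lumpable A B M" "subdist_mat (fst A) (fst B) M"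
  shows "mat_mult (fst B) M (proj B) = mat_mult (Q_obj U A) (proj A) (Q_mat U A B M)"
  unfolding mat_mult_fun_mat_left[OF cls_funcset]
  using Q_mat_row[OF assms(1-3)] subdist_mat_mult[OF assms(4) subdist_mat_proj]
  by (auto simp: fun_eq_iff subdist_mat_outside)

text \<open>By associativity, p M \<pi> = p \<pi> N, where \<pi> is the projection on the respective
  side. Hence the class of the image of \<open>p\<close> depends only on p \<pi>, that is, on the
  class of \<open>p\<close>.\<close>

lemma partitioned_if_factors:
  assumes A: "A \<in> psets U" and B: "B \<in> psets U" and M: "subdist_mat (fst A) (fst B) M"
    and eq: "mat_mult (fst B) M (proj B) = mat_mult (Q_obj U A) (proj A) N"
  shows "partitioned A B M"
  unfolding partitioned_def
proof (intro allI impI)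
  have vec: "vec_mat (fst B) (vec_mat (fst A) p M) (proj B)
      = vec_mat (Q_obj U A) (vec_mat (fst A) p (proj A)) N" if "subdist (fst A) p" for p
  proof -
    have "vec_mat (fst B) (vec_mat (fst A) p M) (proj B)
        = vec_mat (fst A) p (mat_mult (fst B) M (proj B))"
      by (intro vec_mat_assoc subdist_finite_on[OF that] subdist_mat_finite_on[OF M])
    also have "\<dots> = vec_mat (Q_obj U A) (vec_mat (fst A) p (proj A)) N"
      unfolding eq
      by (intro vec_mat_assoc[symmetric] subdist_finite_on[OF that]
          subdist_mat_finite_on[OF subdist_mat_proj])
    finally show ?thesis .
  qed
  fix p q assume "subdist (fst A) p" "subdist (fst A) q" "equiv_subdist A p q"
  then show "equiv_subdist B (vec_mat (fst A) p M) (vec_mat (fst A) q M)"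
    by (simp add: equiv_subdist_iff[OF A] equiv_subdist_iff[OF B] vec)
qed

text \<open>One direction tests on point masses; in the other, lumpability makes the aggregated
  matrix available as a factor through the quotient.\<close>

lemma partitioned_iff_lumpable:
  assumes "A \<in> psets U" "B \<in> psets U" "subdist_mat (fst A) (fst B) M"
  shows "partitioned A B M \<longleftrightarrow> lumpable A B M"
  using partitioned_imp_lumpable[OF assms(1,3)]
    partitioned_if_factors[OF assms proj_Q_mat[OF assms(1,2) _ assms(3)]] by blast

text \<open>The projection onto the quotient is surjective, hence can be cancelled on the left.\<close>

lemma Q_mat_unique:
  assumes A: "A \<in> psets U" and B: "B \<in> psets U" and M: "subdist_mat (fst A) (fst B) M"
    and N: "subdist_mat (Q_obj U A) (Q_obj U B) N"
    and eq: "mat_mult (fst B) M (proj B) = mat_mult (Q_obj U A) (proj A) N"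
  shows "Q_mat U A B M = N"
proof (rule subdist_mat_eqI[OF _ N])
  \<comment> \<open>The mere existence of a factor \<open>N\<close> makes \<open>M\<close>
    partitioned, hence lumpable, so its aggregated matrix is well defined.\<close>
  have lump: "lumpable A B M"
    using partitioned_if_factors[OF A B M eq] partitioned_iff_lumpable[OF A B M] by blast
  show "subdist_mat (Q_obj U A) (Q_obj U B) (Q_mat U A B M)"
    by (rule subdist_mat_Q_mat[OF A B lump M])
  fix c d assume "c \<in> Q_obj U A"
  then obtain x where "x \<in> fst A" "c = cls U A x"
    by (auto simp: Q_obj_eq)
  then show "Q_mat U A B M c d = N c d"
    by (simp add: Q_mat_row[OF A B lump] eq mat_mult_fun_mat_left[OF cls_funcset])
qed

section \<open>Aggregation of matrices of functions\<close>

lemma lumpable_fun_mat: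
  assumes A: "A \<in> psets U" and B: "B \<in> psets U" and f: "f \<in> fst A \<rightarrow> fst B"
    and rel: "\<And>x x'. (x, x') \<in> snd A \<Longrightarrow> (f x, f x') \<in> snd B"
  shows "lumpable A B (fun_mat (fst A) f)"
  unfolding lumpable_def
proof clarify
  fix x x' assume xx': "(x, x') \<in> snd A"
  note mem = psets_rel_mem[OF A xx'] psets_rel_mem[OF B rel[OF xx']]
  have "cls U B (f x) = cls U B (f x')"
    using rel[OF xx'] mem by (simp add: cls_eq_iff[OF B])
  then show "equiv_subdist B (fun_mat (fst A) f x) (fun_mat (fst A) f x')"
    using mem
    by (simp add: equiv_subdist_iff[OF B] mat_mult_fun_mat_left[OF f] fun_mat_def[of "fst B"]
        flip: mat_mult_row)
qed

lemma Q_mat_fun_mat: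
  assumes A: "A \<in> psets U" and B: "B \<in> psets U" and f: "f \<in> fst A \<rightarrow> fst B"
    and g: "\<And>x. x \<in> fst A \<Longrightarrow> g (cls U A x) = cls U B (f x)"
  shows "Q_mat U A B (fun_mat (fst A) f) = fun_mat (Q_obj U A) g"
proof (rule Q_mat_unique[OF A B subdist_mat_fun_mat[OF f] subdist_mat_fun_mat])
  show "g \<in> Q_obj U A \<rightarrow> Q_obj U B"
    using f g by (auto simp: Q_obj_eq)
  show "mat_mult (fst B) (fun_mat (fst A) f) (proj B)
      = mat_mult (Q_obj U A) (proj A) (fun_mat (Q_obj U A) g)"
    by (simp add: mat_mult_fun_mat[OF f] mat_mult_fun_mat[OF cls_funcset] fun_mat_eq_iff g)
qed

section \<open>Aggregation of matrix products and Kronecker products\<close>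

text \<open>The chain M N \<pi> = M \<pi> Q(N) = \<pi> Q(M) Q(N). Existence of this factorization
  shows that composites are partitioned, and its uniqueness gives functoriality.\<close>

lemma proj_mat_mult:
  assumes psets: "A \<in> psets U" "B \<in> psets U" "D \<in> psets U"
    and M: "subdist_mat (fst A) (fst B) M" "lumpable A B M"
    and N: "subdist_mat (fst B) (fst D) N" "lumpable B D N"
  shows "mat_mult (fst D) (mat_mult (fst B) M N) (proj D)
    = mat_mult (Q_obj U A) (proj A) (mat_mult (Q_obj U B) (Q_mat U A B M) (Q_mat U B D N))"
proof -
  have "mat_mult (fst D) (mat_mult (fst B) M N) (proj D)
      = mat_mult (fst B) M (mat_mult (Q_obj U B) (proj B) (Q_mat U B D N))"
    by (simp add: mat_mult_assoc[OF M(1) N(1)] proj_Q_mat[OF psets(2,3) N(2,1)])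
  also have "\<dots> = mat_mult (Q_obj U B) (mat_mult (Q_obj U A) (proj A) (Q_mat U A B M)) (Q_mat U B D N)"
    by (simp add: mat_mult_assoc[OF M(1) subdist_mat_proj, symmetric] proj_Q_mat[OF psets(1,2) M(2,1)])
  also have "\<dots> = mat_mult (Q_obj U A) (proj A) (mat_mult (Q_obj U B) (Q_mat U A B M) (Q_mat U B D N))"
    by (rule mat_mult_assoc[OF subdist_mat_proj subdist_mat_Q_mat[OF psets(1,2) M(2,1)]])
  finally show ?thesis .
qed

lemma lumpable_mat_mult:
  assumes "A \<in> psets U" "B \<in> psets U" "D \<in> psets U"
    and "subdist_mat (fst A) (fst B) M" "lumpable A B M"
    and "subdist_mat (fst B) (fst D) N" "lumpable B D N"
  shows "lumpable A D (mat_mult (fst B) M N)"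
proof -
  have "subdist_mat (fst A) (fst D) (mat_mult (fst B) M N)"
    using assms by (intro subdist_mat_mult)
  then show ?thesis
    using partitioned_if_factors[OF _ _ _ proj_mat_mult[OF assms]] partitioned_iff_lumpable assms
    by blast
qed

lemma Q_mat_mult:
  assumes "A \<in> psets U" "B \<in> psets U" "D \<in> psets U"
    and "subdist_mat (fst A) (fst B) M" "lumpable A B M"
    and "subdist_mat (fst B) (fst D) N" "lumpable B D N"
  shows "Q_mat U A D (mat_mult (fst B) M N)
    = mat_mult (Q_obj U B) (Q_mat U A B M) (Q_mat U B D N)"
  using assms
  by (intro Q_mat_unique proj_mat_mult) (auto intro: subdist_mat_mult subdist_mat_Q_mat)

lemma Q_mat_id:
  assumes "A \<in> psets U"
  shows "Q_mat U A A (id_mat (fst A)) = id_mat (Q_obj U A)"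
  unfolding id_mat_eq_fun_mat by (rule Q_mat_fun_mat) (use assms in auto)

lemma infsum_kron_class:
  assumes "subdist_mat X Y M" "subdist_mat X' Y' N"
  shows "infsum (kron U M N (pair U (x, u))) (snd (pprod U B B') `` {pair U (y, v)})
    = infsum (M x) (snd B `` {y}) * infsum (N u) (snd B' `` {v})"
  unfolding pprod_class
  by (rule infsum_uprod)
    (rule subdist_mat_finite_on[OF assms(1)] subdist_mat_finite_on[OF assms(2)] kron_pair)+

text \<open>A class sum of a row of the Kronecker product is the product of class sums of rows of
  the factors, and each of these depends only on the class of its row index.\<close>

lemma lumpable_kron:
  assumes M: "subdist_mat (fst A) (fst B) M" "lumpable A B M"
    and N: "subdist_mat (fst A') (fst B') N" "lumpable A' B' N"
  shows "lumpable (pprod U A A') (pprod U B B') (kron U M N)"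
  unfolding lumpable_def
proof clarify
  fix s s' assume "(s, s') \<in> snd (pprod U A A')"
  then obtain x u x' u' where s: "s = pair U (x, u)" "s' = pair U (x', u')"
    "(x, x') \<in> snd A" "(u, u') \<in> snd A'"
    by (rule pprod_relE)
  have "equiv_subdist B (M x) (M x')" "equiv_subdist B' (N u) (N u')"
    using M N s by (auto simp: lumpable_def)
  then have "infsum (M x) (snd B `` {y}) = infsum (M x') (snd B `` {y})"
    "infsum (N u) (snd B' `` {v}) = infsum (N u') (snd B' `` {v})"
    if "y \<in> fst B" "v \<in> fst B'" for y v
    using that by (auto simp: equiv_subdist_def split: prod.splits)
  then show "equiv_subdist (pprod U B B') (kron U M N s) (kron U M N s')"
    by (simp add: equiv_subdist_def case_prod_beta s infsum_kron_class[OF M(1) N(1)])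
qed


section \<open>The monoidal category of partitioned matrices\<close>

lemma psubMat_simps [simp]:
  "Obj (psubMat U) = psets U"
  "Ident (psubMat U) A = (A, A, id_mat (fst A))"
  "Comp (psubMat U) (A, B, M) (B', D, N) = (A, D, mat_mult (fst B) M N)"
  "TensorO (psubMat U) = pprod U"
  "TensorA (psubMat U) (A, B, M) (A', B', N) = (pprod U A A', pprod U B B', kron U M N)"
  "UnitO (psubMat U) = pone U"
  "Assoc (psubMat U) A B D = (pprod U (pprod U A B) D, pprod U A (pprod U B D),
     assoc_mat U (fst A) (fst B) (fst D))"
  "LUnit (psubMat U) A = (pprod U (pone U) A, A, lunit_mat U (fst A))"
  "RUnit (psubMat U) A = (pprod U A (pone U), A, runit_mat U (fst A))"
  by (simp_all add: psubMat_def)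

lemma Arr_psubMat:
  "(A, B, M) \<in> Arr (psubMat U) \<longleftrightarrow>
    A \<in> psets U \<and> B \<in> psets U \<and> subdist_mat (fst A) (fst B) M \<and> lumpable A B M"
  by (auto simp: psubMat_def partitioned_iff_lumpable)

lemma hom_psubMat:
  "hom (psubMat U) A B = {f. \<exists>M. f = (A, B, M) \<and> A \<in> psets U \<and> B \<in> psets U \<and>
     subdist_mat (fst A) (fst B) M \<and> lumpable A B M}"
  unfolding hom_def by (auto simp: Arr_psubMat) (auto simp: psubMat_def)

lemma hom_psubMatE:
  assumes "f \<in> hom (psubMat U) A B"
  obtains M where "f = (A, B, M)" "A \<in> psets U" "B \<in> psets U"
    "subdist_mat (fst A) (fst B) M" "lumpable A B M"
  using assms unfolding hom_psubMat by blast

text \<open>The bijection has to preserve and reflect the relation: preservation makes its matrix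
  partitioned, reflection does the same for the matrix of the inverse.\<close>

lemma is_iso_psubMat:
  assumes A: "A \<in> psets U" and B: "B \<in> psets U" and f: "bij_betw f (fst A) (fst B)"
    and rel: "\<And>x x'. x \<in> fst A \<Longrightarrow> x' \<in> fst A \<Longrightarrow> (f x, f x') \<in> snd B \<longleftrightarrow> (x, x') \<in> snd A"
  shows "is_iso (psubMat U) A B (A, B, fun_mat (fst A) f)"
  unfolding is_iso_def
proof (intro conjI bexI)
  let ?g = "inv_into (fst A) f"
  have f': "f \<in> fst A \<rightarrow> fst B" and g': "?g \<in> fst B \<rightarrow> fst A"
    using f bij_betw_inv_into[OF f] by (simp_all only: bij_betw_imp_funcset)
  show "(A, B, fun_mat (fst A) f) \<in> hom (psubMat U) A B"
    using A B f' rel psets_rel_mem[OF A] by (simp add: hom_psubMat subdist_mat_fun_mat lumpable_fun_mat)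
  have "(?g y, ?g y') \<in> snd A" if "(y, y') \<in> snd B" for y y'
  proof -
    note mem = psets_rel_mem[OF B that]
    then have "?g y \<in> fst A" "?g y' \<in> fst A"
      using g' by auto
    then show ?thesis
      using rel that bij_betw_inv_into_right[OF f] mem by metis
  qed
  then show "(B, A, fun_mat (fst B) ?g) \<in> hom (psubMat U) B A"
    using A B g' by (simp add: hom_psubMat subdist_mat_fun_mat lumpable_fun_mat)
qed (simp_all add: mat_mult_fun_mat_inv[OF f])

lemma lumpable_id: "A \<in> psets U \<Longrightarrow> lumpable A A (id_mat (fst A))"
  unfolding id_mat_eq_fun_mat by (rule lumpable_fun_mat) auto

lemma category_psubMat: "category (psubMat U)"
proof
  show "f \<in> Arr (psubMat U) \<Longrightarrow> Dom (psubMat U) f \<in> Obj (psubMat U)"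
    "f \<in> Arr (psubMat U) \<Longrightarrow> Cod (psubMat U) f \<in> Obj (psubMat U)" for f
    by (auto simp: psubMat_def)
qed ((elim hom_psubMatE)?; simp add: hom_psubMat subdist_mat_id lumpable_id mat_mult_id_left
    mat_mult_id_right mat_mult_assoc subdist_mat_mult lumpable_mat_mult)+

lemma is_iso_structure_psubMat:
  assumes "A \<in> psets U" "B \<in> psets U" "D \<in> psets U"
  shows "is_iso (psubMat U) (pprod U (pprod U A B) D) (pprod U A (pprod U B D))
      (Assoc (psubMat U) A B D)"
    and "is_iso (psubMat U) (pprod U (pone U) A) A (LUnit (psubMat U) A)"
    and "is_iso (psubMat U) (pprod U A (pone U)) A (RUnit (psubMat U) A)"
proof -
  note psets = assms pprod_psets pone_psets
  have "is_iso (psubMat U) (pprod U (pprod U A B) D) (pprod U A (pprod U B D))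
      (pprod U (pprod U A B) D, pprod U A (pprod U B D),
        fun_mat (fst (pprod U (pprod U A B) D)) (uassoc U))"
    by (intro is_iso_psubMat psets) (auto simp: bij_betw_uassoc elim!: uprodE)
  then show "is_iso (psubMat U) (pprod U (pprod U A B) D) (pprod U A (pprod U B D))
      (Assoc (psubMat U) A B D)"
    by (simp add: assoc_mat_eq_fun_mat)
  have "is_iso (psubMat U) (pprod U (pone U) A) A
      (pprod U (pone U) A, A, fun_mat (fst (pprod U (pone U) A)) (usnd U))"
    by (intro is_iso_psubMat psets) (auto simp: bij_betw_usnd elim!: uprodE)
  then show "is_iso (psubMat U) (pprod U (pone U) A) A (LUnit (psubMat U) A)"
    by (simp add: lunit_mat_eq_fun_mat)
  have "is_iso (psubMat U) (pprod U A (pone U)) A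
      (pprod U A (pone U), A, fun_mat (fst (pprod U A (pone U))) (ufst U))"
    by (intro is_iso_psubMat psets) (auto simp: bij_betw_ufst elim!: uprodE)
  then show "is_iso (psubMat U) (pprod U A (pone U)) A (RUnit (psubMat U) A)"
    by (simp add: runit_mat_eq_fun_mat)
qed

text \<open>The equations are the matrix identities already used for \<open>subMat U\<close>. New
  are only the closure of partitioned sets and matrices under the operations, and isomorphisms that
  respect the relations.\<close>

lemma monoidal_category_psubMat: "monoidal_category (psubMat U)"
  unfolding monoidal_category_def monoidal_category_axioms_def
  using is_iso_structure_psubMat
  by (intro conjI allI impI; (elim hom_psubMatE)?; simp add: category_psubMat hom_psubMat
      pprod_psets pone_psets subdist_mat_kron lumpable_kron kron_id kron_mat_mult
      assoc_mat_natural lunit_mat_natural runit_mat_natural mat_pentagon mat_triangle)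


section \<open>The monoidal structure of aggregation\<close>

text \<open>The bijection ([x], [y]) \<mapsto> [(x, y)] on codes, by way of representatives chosen
  with \<open>inv_into\<close>; \<open>qmul_cls\<close> shows that the choice does not affect the
  value.\<close>

definition qmul :: "'u pset \<Rightarrow> 'u pset \<Rightarrow> 'u \<Rightarrow> 'u" where
  "qmul A B s = cls U (pprod U A B)
     (umap U (inv_into (fst A) (cls U A)) (inv_into (fst B) (cls U B)) s)"

lemma inv_cls_rel:
  assumes "A \<in> psets U" "x \<in> fst A"
  shows "(inv_into (fst A) (cls U A) (cls U A x), x) \<in> snd A"
  using assms inv_into_into[of "cls U A x" "cls U A" "fst A"]
    f_inv_into_f[of "cls U A x" "cls U A" "fst A"]
  by (simp flip: cls_eq_iff)

lemma qmul_cls [simp]: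
  assumes "A \<in> psets U" "B \<in> psets U" "x \<in> fst A" "y \<in> fst B"
  shows "qmul A B (pair U (cls U A x, cls U B y)) = cls U (pprod U A B) (pair U (x, y))"
  using assms inv_cls_rel[of A x] inv_cls_rel[of B y]
  by (simp add: qmul_def cls_eq_iff pprod_psets inv_into_into)

text \<open>The definition of \<open>Q_mult\<close> ranges over all representatives; by
  \<open>qmul_cls\<close> they give the same class, so the relation there is the graph of
  \<open>qmul A B\<close>.\<close>

lemma Q_mult_eq:
  assumes "A \<in> psets U" "B \<in> psets U"
  shows "Q_mult U A B = (uprod U (Q_obj U A) (Q_obj U B), Q_obj U (pprod U A B),
    fun_mat (uprod U (Q_obj U A) (Q_obj U B)) (qmul A B))"
  unfolding Q_mult_def fun_mat_def prod.inject
  by (intro conjI refl ext arg_cong[of _ _ of_bool])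
    (use assms in \<open>fastforce simp: Q_obj_eq elim!: uprodE\<close>)

lemma bij_betw_qmul:
  assumes "A \<in> psets U" "B \<in> psets U"
  shows "bij_betw (qmul A B) (uprod U (Q_obj U A) (Q_obj U B)) (Q_obj U (pprod U A B))"
  unfolding bij_betw_def
proof
  show "inj_on (qmul A B) (uprod U (Q_obj U A) (Q_obj U B))"
    using assms by (auto simp: inj_on_def Q_obj_eq cls_eq_iff pprod_psets)
  show "qmul A B ` uprod U (Q_obj U A) (Q_obj U B) = Q_obj U (pprod U A B)"
    using assms by (force simp: Q_obj_eq uprod_def image_iff)
qed

lemma qmul_funcset:
  assumes "A \<in> psets U" "B \<in> psets U"
  shows "qmul A B \<in> uprod U (Q_obj U A) (Q_obj U B) \<rightarrow> Q_obj U (pprod U A B)"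
  by (rule bij_betw_imp_funcset[OF bij_betw_qmul[OF assms]])

lemma Q_unit_eq: "Q_unit U = ({pt U}, Q_obj U (pone U), fun_mat {pt U} (cls U (pone U)))"
  by (auto simp: Q_unit_def fun_mat_def fun_eq_iff)

text \<open>As \<open>qmul A' B'\<close> is bijective, comparing entries at representatives
  suffices, and there the claim is the factorization of class sums in
  \<open>infsum_kron_class\<close>.\<close>

lemma Q_mult_natural:
  assumes psets: "A \<in> psets U" "B \<in> psets U" "A' \<in> psets U" "B' \<in> psets U"
    and M: "subdist_mat (fst A) (fst A') M" "lumpable A A' M"
    and N: "subdist_mat (fst B) (fst B') N" "lumpable B B' N"
  shows "mat_mult (uprod U (Q_obj U A') (Q_obj U B'))
      (kron U (Q_mat U A A' M) (Q_mat U B B' N))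
      (fun_mat (uprod U (Q_obj U A') (Q_obj U B')) (qmul A' B'))
    = mat_mult (Q_obj U (pprod U A B)) (fun_mat (uprod U (Q_obj U A) (Q_obj U B)) (qmul A B))
        (Q_mat U (pprod U A B) (pprod U A' B') (kron U M N))"
proof (rule fun_mat_natural)
  show "subdist_mat (uprod U (Q_obj U A) (Q_obj U B)) (uprod U (Q_obj U A') (Q_obj U B'))
      (kron U (Q_mat U A A' M) (Q_mat U B B' N))"
    using assms by (intro subdist_mat_kron subdist_mat_Q_mat)
  show "subdist_mat (Q_obj U (pprod U A B)) (Q_obj U (pprod U A' B'))
      (Q_mat U (pprod U A B) (pprod U A' B') (kron U M N))"
    using assms by (intro subdist_mat_Q_mat pprod_psets lumpable_kron) (simp_all add: subdist_mat_kron)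
  fix s t
  assume "s \<in> uprod U (Q_obj U A) (Q_obj U B)" "t \<in> uprod U (Q_obj U A') (Q_obj U B')"
  then obtain x u y v where "s = pair U (cls U A x, cls U B u)" "x \<in> fst A" "u \<in> fst B"
    "t = pair U (cls U A' y, cls U B' v)" "y \<in> fst A'" "v \<in> fst B'"
    by (auto simp: Q_obj_eq elim!: uprodE)
  then show "kron U (Q_mat U A A' M) (Q_mat U B B' N) s t
      = Q_mat U (pprod U A B) (pprod U A' B') (kron U M N) (qmul A B s) (qmul A' B' t)"
    using assms
    by (simp add: Q_mat_cls pprod_psets lumpable_kron infsum_kron_class[OF M(1) N(1)])
qed (use psets in \<open>simp_all add: qmul_funcset bij_betw_qmul\<close>)

section \<open>Coherence of the structure maps of aggregation\<close>

text \<open>Hides the induced map on classes behind its values, so that the coherence proofs never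
  meet the chosen representatives in its definition.\<close>

lemma Q_mat_fun_mat_rep:
  assumes A: "A \<in> psets U" and B: "B \<in> psets U" and f: "f \<in> fst A \<rightarrow> fst B"
    and rel: "\<And>x x'. (x, x') \<in> snd A \<Longrightarrow> (f x, f x') \<in> snd B"
  obtains g where "Q_mat U A B (fun_mat (fst A) f) = fun_mat (Q_obj U A) g"
    "\<And>x. x \<in> fst A \<Longrightarrow> g (cls U A x) = cls U B (f x)"
proof -
  let ?g = "\<lambda>c. cls U B (f (inv_into (fst A) (cls U A) c))"
  have "?g (cls U A x) = cls U B (f x)" if "x \<in> fst A" for x
    using rel[OF inv_cls_rel[OF A that]] psets_rel_mem[OF B] by (metis cls_eq_iff[OF B])
  then show ?thesis
    using that[of ?g] Q_mat_fun_mat[OF A B f, of ?g] by blast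
qed

text \<open>The aggregated associator is again the matrix of a function. At (([x], [y]), [z]) both
  composites give [(x, (y, z))].\<close>

lemma Q_mult_assoc:
  assumes psets: "A \<in> psets U" "B \<in> psets U" "E \<in> psets U"
  shows "mat_mult (Q_obj U (pprod U (pprod U A B) E))
      (mat_mult (uprod U (Q_obj U (pprod U A B)) (Q_obj U E))
        (kron U (fun_mat (uprod U (Q_obj U A) (Q_obj U B)) (qmul A B)) (id_mat (Q_obj U E)))
        (fun_mat (uprod U (Q_obj U (pprod U A B)) (Q_obj U E)) (qmul (pprod U A B) E)))
      (Q_mat U (pprod U (pprod U A B) E) (pprod U A (pprod U B E))
        (assoc_mat U (fst A) (fst B) (fst E)))
    = mat_mult (uprod U (Q_obj U A) (Q_obj U (pprod U B E)))
        (mat_mult (uprod U (Q_obj U A) (uprod U (Q_obj U B) (Q_obj U E)))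
          (assoc_mat U (Q_obj U A) (Q_obj U B) (Q_obj U E))
          (kron U (id_mat (Q_obj U A)) (fun_mat (uprod U (Q_obj U B) (Q_obj U E)) (qmul B E))))
        (fun_mat (uprod U (Q_obj U A) (Q_obj U (pprod U B E))) (qmul A (pprod U B E)))"
proof -
  let ?L = "pprod U (pprod U A B) E" and ?R = "pprod U A (pprod U B E)"
  have LR: "?L \<in> psets U" "?R \<in> psets U" "pprod U A B \<in> psets U" "pprod U B E \<in> psets U"
    using psets by (auto intro!: pprod_psets)
  have "uassoc U \<in> fst ?L \<rightarrow> fst ?R"
    by (simp add: Pi_iff)
  moreover have "(uassoc U s, uassoc U s') \<in> snd ?R" if "(s, s') \<in> snd ?L" for s s'
    using that by (auto elim!: pprod_relE)
  ultimately obtain g where g: "Q_mat U ?L ?R (fun_mat (fst ?L) (uassoc U)) = fun_mat (Q_obj U ?L) g"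
    "\<And>x. x \<in> fst ?L \<Longrightarrow> g (cls U ?L x) = cls U ?R (uassoc U x)"
    by (rule Q_mat_fun_mat_rep[OF LR(1,2)]) blast+
  \<comment> \<open>Brings the equation for the aggregated associator into the form in which it
    occurs in the goal.\<close>
  note gL = g(1)[simplified fst_pprod, folded assoc_mat_eq_fun_mat]
  show ?thesis
    unfolding gL using psets LR
    by (simp add: assoc_mat_eq_fun_mat id_mat_eq_fun_mat kron_fun_mat mat_mult_fun_mat Pi_iff
        fun_mat_eq_iff ball_Q_obj cls_mem_Q_obj g(2))
qed

text \<open>The composite sends (pt, [x]) through ([pt], [x]) and [(pt, x)] to [x].\<close>

lemma Q_mult_LUnit:
  assumes "A \<in> psets U"
  shows "mat_mult (Q_obj U (pprod U (pone U) A))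
      (mat_mult (uprod U (Q_obj U (pone U)) (Q_obj U A))
        (kron U (fun_mat {pt U} (cls U (pone U))) (id_mat (Q_obj U A)))
        (fun_mat (uprod U (Q_obj U (pone U)) (Q_obj U A)) (qmul (pone U) A)))
      (Q_mat U (pprod U (pone U) A) A (lunit_mat U (fst A)))
    = lunit_mat U (Q_obj U A)"
proof -
  let ?L = "pprod U (pone U) A"
  have L: "?L \<in> psets U"
    using assms by (intro pprod_psets pone_psets)
  have "usnd U \<in> fst ?L \<rightarrow> fst A"
    by (simp add: Pi_iff)
  moreover have "(usnd U s, usnd U s') \<in> snd A" if "(s, s') \<in> snd ?L" for s s'
    using that by (auto elim!: pprod_relE)
  ultimately obtain g where g: "Q_mat U ?L A (fun_mat (fst ?L) (usnd U)) = fun_mat (Q_obj U ?L) g"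
    "\<And>x. x \<in> fst ?L \<Longrightarrow> g (cls U ?L x) = cls U A (usnd U x)"
    by (rule Q_mat_fun_mat_rep[OF L assms]) blast+
  note gL = g(1)[simplified fst_pprod fst_pone, folded lunit_mat_eq_fun_mat]
  show ?thesis
    unfolding gL using assms L pone_psets
    by (simp add: lunit_mat_eq_fun_mat id_mat_eq_fun_mat kron_fun_mat mat_mult_fun_mat Pi_iff
        fun_mat_eq_iff ball_Q_obj cls_mem_Q_obj g(2))
qed

text \<open>Mirror image of the left unit: ([x], pt) goes through ([x], [pt]) and [(x, pt)] to
  [x].\<close>

lemma Q_mult_RUnit:
  assumes "A \<in> psets U"
  shows "mat_mult (Q_obj U (pprod U A (pone U)))
      (mat_mult (uprod U (Q_obj U A) (Q_obj U (pone U)))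
        (kron U (id_mat (Q_obj U A)) (fun_mat {pt U} (cls U (pone U))))
        (fun_mat (uprod U (Q_obj U A) (Q_obj U (pone U))) (qmul A (pone U))))
      (Q_mat U (pprod U A (pone U)) A (runit_mat U (fst A)))
    = runit_mat U (Q_obj U A)"
proof -
  let ?L = "pprod U A (pone U)"
  have L: "?L \<in> psets U"
    using assms by (intro pprod_psets pone_psets)
  have "ufst U \<in> fst ?L \<rightarrow> fst A"
    by (simp add: Pi_iff)
  moreover have "(ufst U s, ufst U s') \<in> snd A" if "(s, s') \<in> snd ?L" for s s'
    using that by (auto elim!: pprod_relE)
  ultimately obtain g where g: "Q_mat U ?L A (fun_mat (fst ?L) (ufst U)) = fun_mat (Q_obj U ?L) g"
    "\<And>x. x \<in> fst ?L \<Longrightarrow> g (cls U ?L x) = cls U A (ufst U x)"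
    by (rule Q_mat_fun_mat_rep[OF L assms]) blast+
  note gL = g(1)[simplified fst_pprod fst_pone, folded runit_mat_eq_fun_mat]
  show ?thesis
    unfolding gL using assms L pone_psets
    by (simp add: runit_mat_eq_fun_mat id_mat_eq_fun_mat kron_fun_mat mat_mult_fun_mat Pi_iff
        fun_mat_eq_iff ball_Q_obj cls_mem_Q_obj g(2))
qed

section \<open>Assembly of the strong monoidal functor\<close>

lemma Q_arr_simps [simp]: "Q_arr U (A, B, M) = (Q_obj U A, Q_obj U B, Q_mat U A B M)"
  by (simp add: Q_arr_def)

lemma cat_functor_Q: "cat_functor (psubMat U) (subMat U) (Q_obj U) (Q_arr U)"
  unfolding cat_functor_def cat_functor_axioms_def
  by (intro conjI allI impI; (elim hom_psubMatE)?; simp add: category_psubMat category_subMat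
      hom_subMat small_Q_obj subdist_mat_Q_mat Q_mat_id Q_mat_mult)

lemma is_iso_Q_mult:
  assumes "A \<in> psets U" "B \<in> psets U"
  shows "is_iso (subMat U) (uprod U (Q_obj U A) (Q_obj U B)) (Q_obj U (pprod U A B)) (Q_mult U A B)"
  unfolding Q_mult_eq[OF assms]
  using assms by (intro is_iso_subMat small_prod small_Q_obj pprod_psets bij_betw_qmul)

lemma is_iso_Q_unit: "is_iso (subMat U) {pt U} (Q_obj U (pone U)) (Q_unit U)"
  unfolding Q_unit_eq
  by (intro is_iso_subMat small_one small_Q_obj pone_psets) (simp add: bij_betw_def Q_obj_eq)

lemma strong_monoidal_functor_Q:
  "strong_monoidal_functor (psubMat U) (subMat U) (Q_obj U) (Q_arr U) (Q_mult U) (Q_unit U)"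
  unfolding strong_monoidal_functor_def strong_monoidal_functor_axioms_def
  using is_iso_Q_mult is_iso_Q_unit Q_mult_natural Q_mult_assoc Q_mult_LUnit Q_mult_RUnit
  by (intro conjI allI impI; (elim hom_psubMatE)?; simp add: monoidal_category_psubMat
      monoidal_category_subMat cat_functor_Q Q_mult_eq Q_unit_eq pprod_psets pone_psets)

end

theorem corollary5p27:
  fixes U :: "'u universe"
  assumes "universe U"
  shows "(\<forall>A B M. (A, B, M) \<in> Arr (psubMat U) \<longrightarrow>
           (\<forall>x\<in>fst A. \<forall>y\<in>fst B.
              Q_mat U A B M (cls U A x) (cls U B y) = (\<Sum>\<^sub>\<infinity>y'\<in>snd B `` {y}. M x y')))
       \<and> strong_monoidal_functor (psubMat U) (subMat U) (Q_obj U) (Q_arr U) (Q_mult U) (Q_unit U)"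
proof -
  interpret universe U by (rule assms)
  \<comment> \<open>With arrows characterized by lumpability, the first conjunct is the
    well-definedness of the aggregated entries.\<close>
  show ?thesis
    using strong_monoidal_functor_Q by (simp add: Arr_psubMat Q_mat_cls)
qed

end
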